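(* Let $R$ be a P$v$MD. The following conditions are equivalent: (i) $R$ satisfies the ascending chain condition on radical $t$-ideals; (ii) $R$ is a $tRTP$-domain satisfying the ascending chain condition on prime $t$-ideals; (iii) $R$ is a $t\#\#$-domain satisfying the ascending chain condition on prime $t$-ideals; (iv) $R$ is a $t\#\#$-domain and each $t$-prime is branched.
   Context: $R$ is an integral domain with quotient field $K\neq R$. For nonzero $R$-submodules $A,B$ of $K$, $(A:B)=\{x\in K: xB\subseteq A\}$. For a nonzero fractional ideal $I$, $I_v=(R:(R:I))$, $I_t=\bigcup\{J_v: J\subseteq I\text{ nonzero finitely generated}\}$; $I$ is a $t$-ideal if $I=I_t$; a $t$-prime is a prime $t$-ideal; a $t$-maximal ideal is an ideal maximal among proper $t$-ideals. $R$ is a P$v$MD if $R_M$ is a valuation domain for every $t$-maximal $M$. A prime $P$ is branched if there is a $P$-primary ideal different from $P$. $R$ is a $t\#\#$-domain if $\bigcap_{P\in\mathcal P_1}R_P\neq\bigcap_{P\in\mathcal P_2}R_P$ for any two distinct sets $\mathcal P_1,\mathcal P_2$ of pairwise incomparable $t$-prime ideals. $R$ is a $tRTP$-domain if for each nonzero ideal $I$, either $(I(R:I))_t=R$ or $(I(R:I))_t$ is a radical ideal. *)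

theory Defs
  imports "HOL-Computational_Algebra.Fraction_Field"
begin

text \<open>The domain R is the type 'a :: idom; its quotient field K is 'a fract.
  R is identified with its image Rf in K.\<close>

definition emb :: "'a::idom \<Rightarrow> 'a fract" where
  "emb a = Fract a 1"

definition Rf :: "'a::idom fract set" where
  "Rf = range emb"

definition colon :: "'a::idom fract set \<Rightarrow> 'a fract set \<Rightarrow> 'a fract set" where
  "colon A B = {x. \<forall>b\<in>B. x * b \<in> A}"

definition vclos :: "'a::idom fract set \<Rightarrow> 'a fract set" where
  "vclos I = colon Rf (colon Rf I)"

definition gen :: "'a::idom fract set \<Rightarrow> 'a fract set" where
  "gen F = {(\<Sum>x\<in>F. emb (c x) * x) | c. True}"

definition tclos :: "'a::idom fract set \<Rightarrow> 'a fract set" where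
  "tclos I = \<Union>{vclos J | J. \<exists>F. finite F \<and> J = gen F \<and> J \<noteq> {0} \<and> J \<subseteq> I}"

definition modprod :: "'a::idom fract set \<Rightarrow> 'a fract set \<Rightarrow> 'a fract set" where
  "modprod A B = {(\<Sum>i<n. a i * b i) | (n::nat) a b. \<forall>i<n. a i \<in> A \<and> b i \<in> B}"

definition is_ideal :: "'a::idom set \<Rightarrow> bool" where
  "is_ideal I \<longleftrightarrow> 0 \<in> I \<and> (\<forall>x\<in>I. \<forall>y\<in>I. x + y \<in> I) \<and> (\<forall>r x. x \<in> I \<longrightarrow> r * x \<in> I)"

definition is_prime_ideal :: "'a::idom set \<Rightarrow> bool" where
  "is_prime_ideal P \<longleftrightarrow> is_ideal P \<and> P \<noteq> UNIV \<and> (\<forall>a b. a * b \<in> P \<longrightarrow> a \<in> P \<or> b \<in> P)"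

definition rad :: "'a::idom set \<Rightarrow> 'a set" where
  "rad I = {x. \<exists>n. x ^ Suc n \<in> I}"

definition is_primary :: "'a::idom set \<Rightarrow> bool" where
  "is_primary Q \<longleftrightarrow> is_ideal Q \<and> Q \<noteq> UNIV \<and>
     (\<forall>a b. a * b \<in> Q \<longrightarrow> a \<in> Q \<or> b \<in> rad Q)"

definition branched :: "'a::idom set \<Rightarrow> bool" where
  "branched P \<longleftrightarrow> (\<exists>Q. is_primary Q \<and> rad Q = P \<and> Q \<noteq> P)"

definition t_ideal :: "'a::idom set \<Rightarrow> bool" where
  "t_ideal I \<longleftrightarrow> is_ideal I \<and> I \<noteq> {0} \<and> tclos (emb ` I) = emb ` I"

definition t_prime :: "'a::idom set \<Rightarrow> bool" where
  "t_prime P \<longleftrightarrow> is_prime_ideal P \<and> t_ideal P"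

definition t_maximal :: "'a::idom set \<Rightarrow> bool" where
  "t_maximal M \<longleftrightarrow> t_ideal M \<and> M \<noteq> UNIV \<and>
     (\<forall>J. t_ideal J \<and> J \<noteq> UNIV \<and> M \<subseteq> J \<longrightarrow> J = M)"

definition loc :: "'a::idom set \<Rightarrow> 'a fract set" where
  "loc P = {Fract a s | a s. s \<notin> P}"

definition valuation_domain :: "'a::idom fract set \<Rightarrow> bool" where
  "valuation_domain V \<longleftrightarrow> (\<forall>x. x \<noteq> 0 \<longrightarrow> x \<in> V \<or> inverse x \<in> V)"

definition PvMD :: "'a::idom itself \<Rightarrow> bool" where
  "PvMD (X::'a itself) \<longleftrightarrow> (\<forall>M::'a set. t_maximal M \<longrightarrow> valuation_domain (loc M))"

definition acc :: "'a set set \<Rightarrow> bool" where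
  "acc S \<longleftrightarrow> (\<forall>f::nat \<Rightarrow> 'a set. (\<forall>n. f n \<in> S) \<and> (\<forall>n. f n \<subseteq> f (Suc n))
      \<longrightarrow> (\<exists>N. \<forall>n\<ge>N. f n = f N))"

definition radical_in_R :: "'a::idom fract set \<Rightarrow> bool" where
  "radical_in_R J \<longleftrightarrow> (\<forall>x\<in>Rf. \<forall>n. x ^ Suc n \<in> J \<longrightarrow> x \<in> J)"

definition tRTP :: "'a::idom itself \<Rightarrow> bool" where
  "tRTP (X::'a itself) \<longleftrightarrow> (\<forall>I::'a set. is_ideal I \<and> I \<noteq> {0} \<longrightarrow>
     (let J = tclos (modprod (emb ` I) (colon Rf (emb ` I))) in J = Rf \<or> radical_in_R J))"

definition pairwise_incomparable :: "'a set set \<Rightarrow> bool" where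
  "pairwise_incomparable S \<longleftrightarrow> (\<forall>P\<in>S. \<forall>Q\<in>S. P \<subseteq> Q \<longrightarrow> P = Q)"

text \<open>The empty intersection is K (= UNIV).\<close>
definition t_sharp_sharp :: "'a::idom itself \<Rightarrow> bool" where
  "t_sharp_sharp (X::'a itself) \<longleftrightarrow> (\<forall>S1 S2 :: 'a set set.
     S1 \<noteq> S2 \<and> (\<forall>P\<in>S1. t_prime P) \<and> (\<forall>P\<in>S2. t_prime P) \<and>
     pairwise_incomparable S1 \<and> pairwise_incomparable S2
     \<longrightarrow> (\<Inter>P\<in>S1. loc P) \<noteq> (\<Inter>P\<in>S2. loc P))"

end

theory Submission
  imports Defs
begin

text \<open>
  In a PvMD every t-prime \<open>P\<close> has a valuation ring as localization, and
  \<open>I\<^sub>t = \<Inter>\<^sub>M I R\<^sub>M\<close>, the intersection being over the maximal t-ideals. By branching theory in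
  valuation rings, the ascending chain condition on t-primes holds iff all t-primes are branched.
  In the presence of this chain condition, each of the other conditions is equivalent to: every
  t-prime \<open>P\<close> is the radical of \<open>J\<^sub>v\<close> for a finitely generated \<open>J\<close>. Given an element \<open>u\<close> of the
  quotient field that lies outside \<open>R\<^sub>P\<close> but in \<open>R\<^sub>Q\<close> for all t-primes \<open>Q\<close> not containing \<open>P\<close>,
  the ideal \<open>(R : (1, u))\<close> is v-finite and has radical \<open>P\<close>. The t##-property yields such a \<open>u\<close>
  from the maximal t-primes not containing \<open>P\<close>, and the trace property yields it from the inverse
  of a \<open>P\<close>-primary ideal \<open>a\<^sup>2 R\<^sub>P \<inter> R\<close>.
  Conversely, if \<open>P\<close> is minimal over a trace ideal \<open>T\<close>, the finitely generated \<open>J\<close> produces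
  elements of the ring \<open>(R : T)\<close>, which acts on \<open>T\<close> and forces \<open>T R\<^sub>M = P R\<^sub>M\<close>.
\<close>

section \<open>Divisibility form of the v- and t-operations\<close>

lemma emb_0 [simp]: "emb 0 = 0"
  by (simp add: emb_def Zero_fract_def)

lemma emb_1 [simp]: "emb 1 = 1"
  by (simp add: emb_def One_fract_def)

lemma emb_add: "emb (a + b) = emb a + emb b"
  by (simp add: emb_def)

lemma emb_mult: "emb (a * b) = emb a * emb b"
  by (simp add: emb_def)

lemma emb_eq_iff [simp]: "emb a = emb b \<longleftrightarrow> a = b"
  by (simp add: emb_def eq_fract)

lemma inj_emb: "inj emb"
  by (simp add: inj_def)

lemma emb_eq_0_iff [simp]: "emb a = 0 \<longleftrightarrow> a = 0"
  using emb_eq_iff[of a 0] by simp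

lemma emb_sum: "emb (sum f A) = (\<Sum>x\<in>A. emb (f x))"
  by (induction A rule: infinite_finite_induct) (auto simp: emb_add)

lemma emb_power: "emb (a ^ n) = emb a ^ n"
  by (induction n) (auto simp: emb_mult)

lemma emb_in_Rf [simp]: "emb a \<in> Rf"
  by (simp add: Rf_def)

lemma Rf_add: "x \<in> Rf \<Longrightarrow> y \<in> Rf \<Longrightarrow> x + y \<in> Rf"
  by (auto simp: Rf_def simp flip: emb_add)

lemma Rf_mult: "x \<in> Rf \<Longrightarrow> y \<in> Rf \<Longrightarrow> x * y \<in> Rf"
  by (auto simp: Rf_def simp flip: emb_mult)

lemma Rf_sum: "(\<And>x. x \<in> A \<Longrightarrow> f x \<in> Rf) \<Longrightarrow> sum f A \<in> Rf"
proof (induction A rule: infinite_finite_induct)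
  case (insert x F)
  then show ?case by (simp add: Rf_add)
qed (metis emb_0 emb_in_Rf sum.infinite sum.empty)+

lemma Fract_eq_emb: "b \<noteq> 0 \<Longrightarrow> Fract a b = emb a / emb b"
  by (simp add: emb_def)

lemma fract_cases_emb:
  fixes x :: "'a::idom fract"
  obtains a b where "b \<noteq> 0" "x = emb a / emb b"
  by (metis Fract_cases Fract_eq_emb)

lemma emb_div_in_Rf_iff: "b \<noteq> 0 \<Longrightarrow> emb a / emb b \<in> Rf \<longleftrightarrow> b dvd a"
proof
  assume b: "b \<noteq> 0"
  show "b dvd a" if ab: "emb a / emb b \<in> Rf"
  proof -
    from ab obtain k where "emb a / emb b = emb k" by (auto simp: Rf_def)
    then have "emb a = emb (b * k)" using b by (simp add: field_simps emb_mult)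
    then show ?thesis by simp
  qed
  show "emb a / emb b \<in> Rf" if ab: "b dvd a"
    using ab b by (auto simp: emb_mult elim!: dvdE)
qed

text \<open>Turns membership in a localization into divisibility up to a factor outside
  \<open>P\<close>; \<open>0 \<in> P\<close> keeps the denominators in \<open>loc P\<close>
  nonzero.\<close>

lemma emb_div_in_loc_iff:
  assumes "0 \<in> P" "b \<noteq> 0"
  shows "emb a / emb b \<in> loc P \<longleftrightarrow> (\<exists>s. s \<notin> P \<and> b dvd s * a)"
proof
  assume "emb a / emb b \<in> loc P"
  then obtain c s where s: "s \<notin> P" "emb a / emb b = Fract c s" by (auto simp: loc_def)
  with assms have "s \<noteq> 0" by auto
  with s assms have "emb (s * a) = emb (b * c)"
    by (simp add: Fract_eq_emb field_simps emb_mult)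
  then show "\<exists>s. s \<notin> P \<and> b dvd s * a" using s by auto
next
  assume "\<exists>s. s \<notin> P \<and> b dvd s * a"
  then obtain s c where s: "s \<notin> P" "s * a = b * c" by (auto elim!: dvdE)
  then have "s \<noteq> 0" using assms by auto
  have "emb s * emb a = emb b * emb c" using s by (simp flip: emb_mult)
  with \<open>s \<noteq> 0\<close> assms have "emb a / emb b = Fract c s"
    by (simp add: Fract_eq_emb field_simps)
  then show "emb a / emb b \<in> loc P" using s by (auto simp: loc_def)
qed

lemma loc_mono: "Q \<subseteq> P \<Longrightarrow> loc P \<subseteq> loc Q"
  by (auto simp: loc_def)

text \<open>Quantifying over the elements \<open>c/d\<close> of \<open>(R : F)\<close>, \<open>in_v F x\<close> says that \<open>x\<close> lies in the v-closure
  of the ideal generated by \<open>F\<close>.\<close>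

definition in_v :: "'a::idom set \<Rightarrow> 'a \<Rightarrow> bool" where
  "in_v F x \<longleftrightarrow> (\<forall>c d. d \<noteq> 0 \<longrightarrow> (\<forall>f\<in>F. d dvd c * f) \<longrightarrow> d dvd c * x)"

text \<open>The t-closure read inside \<open>R\<close>; excluding \<open>F \<subseteq> {0}\<close>
  mirrors the condition \<open>J \<noteq> {0}\<close> in \<open>tclos\<close>.\<close>

definition tcl :: "'a::idom set \<Rightarrow> 'a set" where
  "tcl A = {x. \<exists>F. finite F \<and> F \<subseteq> A \<and> \<not> F \<subseteq> {0} \<and> in_v F x}"

lemma in_v_member: "x \<in> F \<Longrightarrow> in_v F x"
  by (auto simp: in_v_def)

lemma in_v_mono: "in_v F x \<Longrightarrow> F \<subseteq> G \<Longrightarrow> in_v G x"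
  unfolding in_v_def by blast

lemma in_v_trans: "in_v F x \<Longrightarrow> (\<And>f. f \<in> F \<Longrightarrow> in_v G f) \<Longrightarrow> in_v G x"
  unfolding in_v_def by blast

lemma in_v_add: "in_v F x \<Longrightarrow> in_v F y \<Longrightarrow> in_v F (x + y)"
  by (auto simp: in_v_def distrib_left)

lemma in_v_mult: "in_v F x \<Longrightarrow> in_v F (r * x)"
  unfolding in_v_def by (metis dvd_mult mult.left_commute)

text \<open>The factor \<open>r\<close> is absorbed into the numerator \<open>c\<close>. Applied to
  \<open>in_v F 1\<close>, this recovers an element \<open>x\<close> from its multiples by members
  of \<open>F\<close>.\<close>

lemma in_v_scale:
  assumes "in_v F x"
  shows "in_v ((*) r ` F) (r * x)"
  unfolding in_v_def
proof (intro allI impI)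
  fix c d assume "d \<noteq> 0" "\<forall>f\<in>(*) r ` F. d dvd c * f"
  then have "\<forall>f\<in>F. d dvd (c * r) * f" by (simp add: mult.assoc)
  with assms \<open>d \<noteq> 0\<close> have "d dvd (c * r) * x" unfolding in_v_def by blast
  then show "d dvd c * (r * x)" by (simp add: mult.assoc)
qed

lemma gen_superset:
  assumes "finite F"
  shows "F \<subseteq> gen F"
proof
  fix f assume f: "f \<in> F"
  define c :: "'a fract \<Rightarrow> 'a" where "c = (\<lambda>x. if x = f then 1 else 0)"
  have "f = (\<Sum>x\<in>F. emb (c x) * x)"
    using assms f by (subst sum.remove[OF assms f]) (auto simp: c_def)
  then show "f \<in> gen F" unfolding gen_def by blast
qed

lemma colon_Rf_gen:
  assumes "finite F"
  shows "colon Rf (gen F) = {y. \<forall>f\<in>F. y * f \<in> Rf}"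
proof (intro equalityI subsetI CollectI ballI)
  fix y f assume y: "y \<in> colon Rf (gen F)" and f: "f \<in> F"
  then have "f \<in> gen F" using gen_superset[OF assms] by blast
  with y show "y * f \<in> Rf" by (auto simp: colon_def)
next
  fix y assume y: "y \<in> {y. \<forall>f\<in>F. y * f \<in> Rf}"
  show "y \<in> colon Rf (gen F)" unfolding colon_def
  proof (intro CollectI ballI)
    fix b assume "b \<in> gen F"
    then obtain c where b: "b = (\<Sum>x\<in>F. emb (c x) * x)" by (auto simp: gen_def)
    have "y * b = (\<Sum>x\<in>F. emb (c x) * (y * x))"
      by (simp add: b sum_distrib_left ac_simps)
    also have "\<dots> \<in> Rf" using y by (intro Rf_sum Rf_mult[OF emb_in_Rf]) auto
    finally show "y * b \<in> Rf" .
  qed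
qed

lemma vclos_gen_emb:
  assumes "finite F"
  shows "vclos (gen (emb ` F)) = emb ` {x. in_v F x}"
proof (intro equalityI subsetI)
  fix x assume "x \<in> vclos (gen (emb ` F))"
  then have x: "x * y \<in> Rf" if "\<forall>f\<in>F. y * emb f \<in> Rf" for y
    using that assms by (simp add: vclos_def colon_Rf_gen) (simp add: colon_def)
  \<comment> \<open>Since \<open>1\<close> maps generators from \<open>R\<close> into
    \<open>R\<close>, the v-closure stays inside \<open>R\<close>.\<close>
  have "x * 1 \<in> Rf" by (rule x) simp
  then obtain z where z: "x = emb z" by (auto simp: Rf_def)
  have "in_v F z" unfolding in_v_def
  proof (intro allI impI)
    fix c d :: 'a assume d: "d \<noteq> 0" "\<forall>f\<in>F. d dvd c * f"
    have "x * (emb c / emb d) \<in> Rf"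
    proof (rule x, intro ballI)
      fix f assume "f \<in> F"
      then have "emb (c * f) / emb d \<in> Rf" using d by (simp add: emb_div_in_Rf_iff)
      then show "emb c / emb d * emb f \<in> Rf" by (simp add: emb_mult)
    qed
    then have "emb (c * z) / emb d \<in> Rf" by (simp add: z emb_mult mult.commute)
    then show "d dvd c * z" using d by (simp add: emb_div_in_Rf_iff)
  qed
  then show "x \<in> emb ` {x. in_v F x}" using z by auto
next
  fix x assume "x \<in> emb ` {x. in_v F x}"
  then obtain z where z: "x = emb z" "in_v F z" by auto
  show "x \<in> vclos (gen (emb ` F))"
    unfolding vclos_def using assms
  proof (simp add: colon_Rf_gen, unfold colon_def, intro CollectI ballI)
    fix y assume "y \<in> {y. \<forall>f\<in>F. y * emb f \<in> Rf}"
    then have y: "\<forall>f\<in>F. y * emb f \<in> Rf" by simp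
    obtain c d where d: "d \<noteq> 0" "y = emb c / emb d" by (rule fract_cases_emb)
    have "d dvd c * f" if "f \<in> F" for f
      using y that d by (simp add: emb_div_in_Rf_iff[OF d(1), symmetric] emb_mult)
    then have "d dvd c * z" using z d by (auto simp: in_v_def)
    then show "x * y \<in> Rf"
      using z d by (simp add: emb_div_in_Rf_iff[OF d(1), symmetric] emb_mult mult.commute)
  qed
qed

section \<open>Ideals of \<open>R\<close> and their t-closures\<close>

lemma ideal_0: "is_ideal I \<Longrightarrow> 0 \<in> I"
  and ideal_add: "is_ideal I \<Longrightarrow> x \<in> I \<Longrightarrow> y \<in> I \<Longrightarrow> x + y \<in> I"
  and ideal_multl: "is_ideal I \<Longrightarrow> x \<in> I \<Longrightarrow> r * x \<in> I"
  by (auto simp: is_ideal_def)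

lemma ideal_multr: "is_ideal I \<Longrightarrow> x \<in> I \<Longrightarrow> x * r \<in> I"
  by (simp add: ideal_multl mult.commute)

lemma ideal_dvd: "is_ideal I \<Longrightarrow> x \<in> I \<Longrightarrow> x dvd y \<Longrightarrow> y \<in> I"
  by (auto simp: ideal_multr elim: dvdE)

lemma ideal_sum: "is_ideal I \<Longrightarrow> (\<And>x. x \<in> A \<Longrightarrow> f x \<in> I) \<Longrightarrow> sum f A \<in> I"
  by (induction A rule: infinite_finite_induct) (auto simp: ideal_0 ideal_add)

lemma ideal_eq_UNIV_iff: "is_ideal I \<Longrightarrow> I = UNIV \<longleftrightarrow> 1 \<in> I"
  by (metis UNIV_eq_I UNIV_I ideal_dvd one_dvd)

lemma ideal_Inter: "(\<And>I. I \<in> C \<Longrightarrow> is_ideal I) \<Longrightarrow> is_ideal (\<Inter>C)"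
  unfolding is_ideal_def[of "\<Inter>C"] by (auto intro: ideal_0 ideal_add ideal_multl)

lemma gen_emb_subset_iff:
  assumes "is_ideal I" "finite F"
  shows "gen (emb ` F) \<subseteq> emb ` I \<longleftrightarrow> F \<subseteq> I"
proof
  assume sub: "gen (emb ` F) \<subseteq> emb ` I"
  then show "F \<subseteq> I" using gen_superset[of "emb ` F"] assms by fastforce
next
  assume sub: "F \<subseteq> I"
  show "gen (emb ` F) \<subseteq> emb ` I"
  proof
    fix x assume "x \<in> gen (emb ` F)"
    then obtain c where "x = (\<Sum>x\<in>emb ` F. emb (c x) * x)" by (auto simp: gen_def)
    also have "\<dots> = (\<Sum>x\<in>F. emb (c (emb x)) * emb x)"
      by (rule sum.reindex_cong[of emb]) (auto intro: inj_onI)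
    also have "\<dots> = emb (\<Sum>x\<in>F. c (emb x) * x)" by (simp add: emb_sum emb_mult)
    finally show "x \<in> emb ` I"
      using assms sub by (auto intro!: imageI ideal_sum ideal_multl)
  qed
qed

lemma gen_subset_embE:
  assumes "finite G" "gen G \<subseteq> emb ` I"
  obtains F where "finite F" "G = emb ` F"
proof -
  have "G \<subseteq> gen G" by (rule gen_superset[OF assms(1)])
  with assms have "G \<subseteq> range emb" by auto
  with assms(1) that show ?thesis by (meson finite_subset_image)
qed

lemma ideal_zero: "is_ideal {0}"
  by (simp add: is_ideal_def)

lemma gen_emb_eq_0_iff:
  assumes "finite F"
  shows "gen (emb ` F) = {0} \<longleftrightarrow> F \<subseteq> {0}"
proof -
  have "0 \<in> gen (emb ` F)"
    unfolding gen_def by (intro CollectI exI[of _ "\<lambda>_. 0"]) simp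
  then have "gen (emb ` F) = {0} \<longleftrightarrow> gen (emb ` F) \<subseteq> emb ` {0}" by auto
  then show ?thesis by (simp only: gen_emb_subset_iff[OF ideal_zero assms])
qed

text \<open>The bridge that lets the rest of the development work with elements of \<open>R\<close>
  and divisibility instead of submodules of the quotient field.\<close>

lemma tclos_emb:
  assumes "is_ideal I"
  shows "tclos (emb ` I) = emb ` tcl I"
proof (intro equalityI subsetI)
  fix x assume "x \<in> tclos (emb ` I)"
  then obtain G where G: "finite G" "gen G \<noteq> {0}" "gen G \<subseteq> emb ` I" "x \<in> vclos (gen G)"
    by (auto simp: tclos_def)
  then obtain F where F: "finite F" "G = emb ` F" by (meson gen_subset_embE)
  then have "F \<subseteq> I" "\<not> F \<subseteq> {0}" "x \<in> emb ` {x. in_v F x}"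
    using G assms by (simp_all add: gen_emb_subset_iff gen_emb_eq_0_iff vclos_gen_emb)
  then show "x \<in> emb ` tcl I" using F unfolding tcl_def by blast
next
  fix x assume "x \<in> emb ` tcl I"
  then obtain z F where z: "x = emb z" "finite F" "F \<subseteq> I" "\<not> F \<subseteq> {0}" "in_v F z"
    unfolding tcl_def by blast
  then have "x \<in> vclos (gen (emb ` F))" "gen (emb ` F) \<noteq> {0}" "gen (emb ` F) \<subseteq> emb ` I"
    using assms by (simp_all add: gen_emb_subset_iff gen_emb_eq_0_iff vclos_gen_emb)
  then show "x \<in> tclos (emb ` I)" unfolding tclos_def using z(2) by blast
qed

lemma tcl_superset:
  assumes "is_ideal I" "I \<noteq> {0}"
  shows "I \<subseteq> tcl I"
proof
  fix x assume x: "x \<in> I"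
  obtain a where "a \<in> I" "a \<noteq> 0" using assms ideal_0 by blast
  with x show "x \<in> tcl I"
    unfolding tcl_def by (intro CollectI exI[of _ "{a, x}"]) (auto intro: in_v_member)
qed

lemma t_ideal_iff:
  "t_ideal I \<longleftrightarrow> is_ideal I \<and> I \<noteq> {0} \<and> (\<forall>F x. finite F \<and> F \<subseteq> I \<and> in_v F x \<longrightarrow> x \<in> I)"
proof (cases "is_ideal I \<and> I \<noteq> {0}")
  case True
  then have "t_ideal I \<longleftrightarrow> tcl I = I"
    by (simp add: t_ideal_def tclos_emb inj_image_eq_iff[OF inj_emb])
  also have "\<dots> \<longleftrightarrow> tcl I \<subseteq> I" using True tcl_superset by blast
  also have "\<dots> \<longleftrightarrow> (\<forall>F x. finite F \<and> F \<subseteq> I \<and> in_v F x \<longrightarrow> x \<in> I)"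
  proof (intro iffI allI impI)
    fix F x assume sub: "tcl I \<subseteq> I" and F: "finite F \<and> F \<subseteq> I \<and> in_v F x"
    obtain a where "a \<in> I" "a \<noteq> 0" using True ideal_0 by blast
    then have "x \<in> tcl I" unfolding tcl_def using F
      by (intro CollectI exI[of _ "insert a F"]) (auto elim: in_v_mono)
    with sub show "x \<in> I" by auto
  qed (auto simp: tcl_def)
  finally show ?thesis using True by simp
qed (auto simp: t_ideal_def)

lemma t_ideal_ideal: "t_ideal I \<Longrightarrow> is_ideal I"
  by (simp add: t_ideal_def)

lemma t_ideal_nonzero:
  assumes "t_ideal I"
  obtains a where "a \<in> I" "a \<noteq> 0"
  using assms ideal_0 unfolding t_ideal_def by blast

lemma t_ideal_in_v: "t_ideal I \<Longrightarrow> finite F \<Longrightarrow> F \<subseteq> I \<Longrightarrow> in_v F x \<Longrightarrow> x \<in> I"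
  by (auto simp: t_ideal_iff)

lemma t_ideal_tcl:
  assumes I: "is_ideal I" "I \<noteq> {0}"
  shows "t_ideal (tcl I)"
proof -
  obtain a where a: "a \<in> I" "a \<noteq> 0" using I ideal_0 by blast
  \<comment> \<open>Finitely many elements of the t-closure are witnessed by one common finite
    subset of \<open>I\<close>; this is what makes the closure idempotent.\<close>
  have fin: "\<exists>H. finite H \<and> H \<subseteq> I \<and> \<not> H \<subseteq> {0} \<and> (\<forall>g\<in>G. in_v H g)"
    if "finite G" "G \<subseteq> tcl I" for G
    using that
  proof (induction G)
    case empty
    show ?case using a by (intro exI[of _ "{a}"]) auto
  next
    case (insert g G)
    then obtain H F where "finite H \<and> H \<subseteq> I \<and> \<not> H \<subseteq> {0} \<and> (\<forall>g\<in>G. in_v H g)"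
      "finite F" "F \<subseteq> I" "in_v F g" by (auto simp: tcl_def)
    then show ?case by (intro exI[of _ "H \<union> F"]) (auto elim: in_v_mono)
  qed
  have closed: "x \<in> tcl I" if "finite G" "G \<subseteq> tcl I" "in_v G x" for G x
    using fin[OF that(1,2)] in_v_trans[OF that(3)] unfolding tcl_def by blast
  have "is_ideal (tcl I)" unfolding is_ideal_def
  proof (intro conjI ballI allI impI)
    show "0 \<in> tcl I" using tcl_superset[OF I] ideal_0[OF I(1)] by auto
    fix x y assume "x \<in> tcl I" "y \<in> tcl I"
    then show "x + y \<in> tcl I"
      by (intro closed[of "{x, y}"]) (auto intro: in_v_add in_v_member)
  next
    fix r x assume "x \<in> tcl I"
    then show "r * x \<in> tcl I"
      by (intro closed[of "{x}"]) (auto intro: in_v_mult in_v_member)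
  qed
  moreover have "tcl I \<noteq> {0}" using a tcl_superset[OF I] by auto
  ultimately show ?thesis using closed by (auto simp: t_ideal_iff)
qed

section \<open>Maximal t-ideals\<close>

lemma chain_finite_subset:
  assumes "finite F" "F \<subseteq> \<Union>C" "C \<noteq> {}" "\<And>X Y. X \<in> C \<Longrightarrow> Y \<in> C \<Longrightarrow> X \<subseteq> Y \<or> Y \<subseteq> X"
  shows "\<exists>X\<in>C. F \<subseteq> X"
  using assms(1,2)
proof (induction F)
  case empty
  then show ?case using assms(3) by auto
next
  case (insert x F)
  then obtain X Y where "X \<in> C" "F \<subseteq> X" "Y \<in> C" "x \<in> Y" by auto
  with assms(4)[of X Y] show ?case by blast
qed

lemma mono_range_chain:
  fixes f :: "nat \<Rightarrow> 'a set"
  assumes "mono f" "X \<in> range f" "Y \<in> range f"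
  shows "X \<subseteq> Y \<or> Y \<subseteq> X"
proof -
  obtain m n where "X = f m" "Y = f n" using assms(2,3) by auto
  then show ?thesis using monoD[OF assms(1)] nat_le_linear[of m n] by auto
qed

text \<open>The t-operation has finite character: each finite subset of the union already lies in
  one member of the chain.\<close>

lemma t_ideal_Union_chain:
  assumes C: "C \<noteq> {}" "\<And>X Y. X \<in> C \<Longrightarrow> Y \<in> C \<Longrightarrow> X \<subseteq> Y \<or> Y \<subseteq> X"
    and t: "\<And>X. X \<in> C \<Longrightarrow> t_ideal X"
  shows "t_ideal (\<Union>C)"
proof -
  have closed: "x \<in> \<Union>C" if F: "finite F" "F \<subseteq> \<Union>C" "in_v F x" for F x
  proof -
    obtain X where "X \<in> C" "F \<subseteq> X" using chain_finite_subset[OF F(1,2) C] by blast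
    then show ?thesis using t_ideal_in_v[OF t] F by blast
  qed
  obtain X where X: "X \<in> C" using C by auto
  obtain a where a: "a \<in> X" "a \<noteq> 0" using t_ideal_nonzero[OF t[OF X]] .
  have "is_ideal (\<Union>C)" unfolding is_ideal_def
  proof (intro conjI ballI allI impI)
    show "0 \<in> \<Union>C" using t[OF X] X ideal_0 t_ideal_ideal by blast
    fix x y assume "x \<in> \<Union>C" "y \<in> \<Union>C"
    then show "x + y \<in> \<Union>C"
      by (intro closed[of "{x, y}"]) (auto intro: in_v_add in_v_member)
  next
    fix r x assume "x \<in> \<Union>C"
    then show "r * x \<in> \<Union>C"
      by (intro closed[of "{x}"]) (auto intro: in_v_mult in_v_member)
  qed
  moreover have "\<Union>C \<noteq> {0}" using a X by auto
  ultimately show ?thesis using closed by (auto simp: t_ideal_iff)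
qed

text \<open>Zorn's lemma; unions of chains stay proper because \<open>1\<close> lies in no
  member.\<close>

lemma t_ideal_in_t_maximal:
  assumes I: "t_ideal I" "I \<noteq> UNIV"
  obtains M where "t_maximal M" "I \<subseteq> M"
proof -
  define A where "A = {J. t_ideal J \<and> J \<noteq> UNIV \<and> I \<subseteq> J}"
  have "\<exists>M\<in>A. \<forall>X\<in>A. M \<subseteq> X \<longrightarrow> X = M"
  proof (rule subset_Zorn_nonempty)
    show "A \<noteq> {}" using I by (auto simp: A_def)
    fix C assume C: "C \<noteq> {}" "subset.chain A C"
    then have sub: "C \<subseteq> A" and ch: "\<And>X Y. X \<in> C \<Longrightarrow> Y \<in> C \<Longrightarrow> X \<subseteq> Y \<or> Y \<subseteq> X"
      by (auto simp: subset_chain_def)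
    have t: "t_ideal (\<Union>C)"
      using sub by (intro t_ideal_Union_chain[OF C(1) ch]) (auto simp: A_def)
    have "1 \<notin> \<Union>C" using sub ideal_eq_UNIV_iff t_ideal_ideal unfolding A_def by blast
    with t C(1) sub show "\<Union>C \<in> A" by (auto simp: A_def)
  qed
  then obtain M where M: "M \<in> A" "\<forall>X\<in>A. M \<subseteq> X \<longrightarrow> X = M" by auto
  have "t_maximal M" using M unfolding t_maximal_def A_def by blast
  with M that show ?thesis by (auto simp: A_def)
qed

lemma ideal_adjoin:
  assumes "is_ideal I"
  shows "is_ideal {x + r * a | x r. x \<in> I}"
  unfolding is_ideal_def
proof (intro conjI ballI allI impI)
  show "0 \<in> {x + r * a | x r. x \<in> I}"
    using ideal_0[OF assms] by (intro CollectI exI[of _ 0]) auto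
  fix x y assume "x \<in> {x + r * a | x r. x \<in> I}" "y \<in> {x + r * a | x r. x \<in> I}"
  then obtain u r v s where "x = u + r * a" "u \<in> I" "y = v + s * a" "v \<in> I" by blast
  then show "x + y \<in> {x + r * a | x r. x \<in> I}" using assms
    by (intro CollectI exI[of _ "u + v"] exI[of _ "r + s"]) (auto simp: ideal_add algebra_simps)
next
  fix r x assume "x \<in> {x + r * a | x r. x \<in> I}"
  then obtain u s where "x = u + s * a" "u \<in> I" by blast
  then show "r * x \<in> {x + r * a | x r. x \<in> I}" using assms
    by (intro CollectI exI[of _ "r * u"] exI[of _ "r * s"]) (auto simp: ideal_multl algebra_simps)
qed

text \<open>If \<open>a \<notin> M\<close>, maximality makes the t-closure of \<open>M + R a\<close>
  all of \<open>R\<close>. Hence \<open>1\<close> is in the v-closure of a finite \<open>F\<close>,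
  and scaling by \<open>b\<close> puts \<open>b\<close> in \<open>M\<close>, as
  \<open>a * b \<in> M\<close> sends \<open>F\<close> into \<open>M\<close>.\<close>

lemma t_maximal_prime:
  assumes M: "t_maximal M"
  shows "t_prime M"
proof -
  have t: "t_ideal M" and id: "is_ideal M" and ne: "M \<noteq> UNIV"
    using M by (auto simp: t_maximal_def t_ideal_ideal)
  have "b \<in> M" if ab: "a * b \<in> M" and a: "a \<notin> M" for a b
  proof -
    define I where "I = {x + r * a | x r. x \<in> M}"
    have I: "is_ideal I" using ideal_adjoin[OF id] by (simp add: I_def)
    have MI: "M \<subseteq> I" unfolding I_def by force
    have "a \<in> I" unfolding I_def using ideal_0[OF id]
      by (intro CollectI exI[of _ 0] exI[of _ 1]) auto
    have "I \<noteq> {0}" using \<open>a \<in> I\<close> a ideal_0[OF id] by auto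
    note tI = t_ideal_tcl[OF I this] and supI = tcl_superset[OF I this]
    have "tcl I = UNIV"
    proof (rule ccontr)
      assume "tcl I \<noteq> UNIV"
      then have "tcl I = M" using M tI MI supI unfolding t_maximal_def by blast
      with supI \<open>a \<in> I\<close> a show False by auto
    qed
    then have "1 \<in> tcl I" by simp
    then obtain F where F: "finite F" "F \<subseteq> I" "in_v F 1" by (auto simp: tcl_def)
    have "in_v ((*) b ` F) (b * 1)" using F by (intro in_v_scale)
    moreover have "(*) b ` F \<subseteq> M"
    proof safe
      fix f assume "f \<in> F"
      then obtain x r where "f = x + r * a" "x \<in> M" using F by (auto simp: I_def)
      then have "b * f = b * x + r * (a * b)" by (simp add: algebra_simps)
      also have "\<dots> \<in> M" using id ab \<open>x \<in> M\<close> by (simp add: ideal_add ideal_multl)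
      finally show "b * f \<in> M" .
    qed
    ultimately show "b \<in> M" using t_ideal_in_v[OF t, of "(*) b ` F" b] F by simp
  qed
  then show ?thesis using t id ne unfolding t_prime_def is_prime_ideal_def by blast
qed

lemma t_prime_simps:
  assumes "t_prime P"
  shows "is_ideal P" "P \<noteq> UNIV" "t_ideal P" "0 \<in> P" "1 \<notin> P" "P \<noteq> {0}"
    and "a * b \<in> P \<longleftrightarrow> a \<in> P \<or> b \<in> P"
    and "a ^ Suc n \<in> P \<longleftrightarrow> a \<in> P"
proof -
  show 1: "is_ideal P" "P \<noteq> UNIV" "t_ideal P" "0 \<in> P" "1 \<notin> P" "P \<noteq> {0}"
    using assms ideal_eq_UNIV_iff[of P]
    by (auto simp: t_prime_def is_prime_ideal_def ideal_0 t_ideal_def)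
  show 2: "a * b \<in> P \<longleftrightarrow> a \<in> P \<or> b \<in> P" for a b
    using assms 1 by (auto simp: t_prime_def is_prime_ideal_def ideal_multl ideal_multr)
  show "a ^ Suc n \<in> P \<longleftrightarrow> a \<in> P"
    by (induction n) (use 2 in auto)
qed

lemma t_prime_dvd: "t_prime P \<Longrightarrow> a \<in> P \<Longrightarrow> a dvd b \<Longrightarrow> b \<in> P"
  using ideal_dvd t_prime_simps(1) by blast

lemma t_prime_power_notin: "t_prime P \<Longrightarrow> a \<notin> P \<Longrightarrow> a ^ n \<notin> P"
  by (cases n) (auto simp: t_prime_simps simp del: power_Suc)

lemma t_prime_prod_notin:
  assumes "t_prime P" "\<And>x. x \<in> A \<Longrightarrow> f x \<notin> P"
  shows "prod f A \<notin> P"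
  using assms(2)
  by (induction A rule: infinite_finite_induct) (auto simp: t_prime_simps[OF assms(1)])

lemma t_prime_in_t_maximal:
  assumes "t_prime P"
  obtains M where "t_maximal M" "t_prime M" "P \<subseteq> M"
  using assms t_ideal_in_t_maximal[of P] t_maximal_prime t_prime_simps by metis

text \<open>The local-to-global device of the whole proof: an ideal of denominators contained in no
  maximal t-ideal has t-closure \<open>R\<close>, and finitely many of its elements witness
  this.\<close>

lemma comaximal_in_v_1:
  assumes D: "is_ideal D" "D \<noteq> {0}" and no: "\<And>M. t_maximal M \<Longrightarrow> \<not> D \<subseteq> M"
  obtains F where "finite F" "F \<subseteq> D" "\<not> F \<subseteq> {0}" "in_v F 1"
proof -
  have "tcl D = UNIV"
  proof (rule ccontr)
    assume "tcl D \<noteq> UNIV"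
    with t_ideal_tcl[OF D] obtain M where "t_maximal M" "tcl D \<subseteq> M"
      by (rule t_ideal_in_t_maximal)
    with no tcl_superset[OF D] show False by blast
  qed
  then have "1 \<in> tcl D" by simp
  then show ?thesis using that by (auto simp: tcl_def)
qed

text \<open>R is the intersection of its localizations at the maximal t-ideals.\<close>

lemma dvd_if_locally_dvd:
  assumes "d \<noteq> 0" and loc: "\<And>M. t_maximal M \<Longrightarrow> \<exists>s. s \<notin> M \<and> d dvd s * c"
  shows "d dvd c"
proof -
  \<comment> \<open>The denominators of the fraction \<open>c/d\<close>; the hypothesis says that no
    maximal t-ideal contains them all.\<close>
  define D where "D = {s. d dvd s * c}"
  have D1: "is_ideal D" unfolding is_ideal_def D_def
    by (simp add: distrib_right mult.assoc)
  have "d \<in> D" by (simp add: D_def)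
  then have D2: "D \<noteq> {0}" using assms(1) by blast
  have D3: "\<not> D \<subseteq> M" if "t_maximal M" for M using loc[OF that] by (auto simp: D_def)
  obtain F where "F \<subseteq> D" "in_v F 1"
    using comaximal_in_v_1[OF D1 D2 D3] by blast
  then have "\<forall>f\<in>F. d dvd c * f" by (auto simp: D_def mult.commute[of c])
  then have "d dvd c * 1" using \<open>in_v F 1\<close> assms(1) unfolding in_v_def by blast
  then show ?thesis by simp
qed

lemma in_tcl_if_locally:
  assumes A: "is_ideal A" "A \<noteq> {0}" and loc: "\<And>M. t_maximal M \<Longrightarrow> \<exists>s. s \<notin> M \<and> s * x \<in> A"
  shows "x \<in> tcl A"
\<comment> \<open>For \<open>x = 0\<close> the scaled generators used below would all vanish, which
  \<open>tcl\<close> does not allow.\<close>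
proof (cases "x = 0")
  case True
  then show ?thesis using tcl_superset[OF A] ideal_0[OF A(1)] by auto
next
  case False
  define D where "D = {s. s * x \<in> A}"
  have AD: "A \<subseteq> D" using A by (auto simp: D_def ideal_multr)
  have D1: "is_ideal D" unfolding is_ideal_def[of D] using A(1)
    by (simp add: D_def distrib_right mult.assoc ideal_0 ideal_add ideal_multl)
  have D2: "D \<noteq> {0}" using AD A ideal_0[OF A(1)] by blast
  have D3: "\<not> D \<subseteq> M" if "t_maximal M" for M using loc[OF that] by (auto simp: D_def)
  obtain F where F: "finite F" "F \<subseteq> D" "\<not> F \<subseteq> {0}" "in_v F 1"
    using comaximal_in_v_1[OF D1 D2 D3] by blast
  have "in_v ((*) x ` F) (x * 1)" using F by (intro in_v_scale)
  moreover have "(*) x ` F \<subseteq> A" "\<not> (*) x ` F \<subseteq> {0}"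
    using F False by (auto simp: D_def mult.commute[of x])
  ultimately show ?thesis
    using F unfolding tcl_def by (intro CollectI exI[of _ "(*) x ` F"]) simp
qed

section \<open>Localization at t-primes of a PvMD\<close>

text \<open>A t-prime is \<open>t_finite\<close> iff it is the radical of the v-closure of a finitely generated ideal;
  \<open>loc_rad T M\<close> is the contraction to \<open>R\<close> of the radical of \<open>T R\<^sub>M\<close>.\<close>

definition t_finite :: "'a::idom set \<Rightarrow> bool" where
  "t_finite P \<longleftrightarrow> (\<exists>F. finite F \<and> F \<subseteq> P \<and> (\<forall>Q. t_prime Q \<longrightarrow> F \<subseteq> Q \<longrightarrow> P \<subseteq> Q))"

definition loc_rad :: "'a::idom set \<Rightarrow> 'a set \<Rightarrow> 'a set" where
  "loc_rad T M = {y. \<exists>s n. s \<notin> M \<and> s * y ^ Suc n \<in> T}"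

text \<open>Otherwise iterating a choice of strictly larger members, starting at \<open>x\<close>,
  gives a chain that never stabilizes.\<close>

lemma acc_maximal:
  assumes S: "acc S" and C: "C \<subseteq> S" "x \<in> C"
  shows "\<exists>m\<in>C. x \<subseteq> m \<and> (\<forall>y\<in>C. m \<subseteq> y \<longrightarrow> y = m)"
proof (rule ccontr)
  assume "\<not> ?thesis"
  then have "\<forall>m. \<exists>y. m \<in> C \<and> x \<subseteq> m \<longrightarrow> y \<in> C \<and> m \<subset> y"
    unfolding psubset_eq by metis
  then obtain g where g: "\<forall>m. m \<in> C \<and> x \<subseteq> m \<longrightarrow> g m \<in> C \<and> m \<subset> g m"
    using choice[of "\<lambda>m y. m \<in> C \<and> x \<subseteq> m \<longrightarrow> y \<in> C \<and> m \<subset> y"] by auto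
  define f where "f n = (g ^^ n) x" for n
  have f: "f n \<in> C \<and> x \<subseteq> f n" for n
  proof (induction n)
    case (Suc n)
    then have "g (f n) \<in> C" "f n \<subset> g (f n)" using g by simp_all
    with Suc show ?case by (simp add: f_def) blast
  qed (simp add: f_def C)
  have step: "f n \<subset> f (Suc n)" for n using g f[of n] by (simp add: f_def)
  have "\<exists>N. \<forall>n\<ge>N. f n = f N"
  proof (rule S[unfolded acc_def, rule_format], intro conjI allI)
    show "f n \<in> S" for n using f C(1) by blast
    show "f n \<subseteq> f (Suc n)" for n using step by (rule psubset_imp_subset)
  qed
  then obtain N where "f (Suc N) = f N" using le_SucI[OF order_refl] by blast
  with step[of N] show False by simp
qed

section \<open>Valuation arguments at t-primes\<close>

locale pvmd_domain =
  fixes R :: "'a::idom itself"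
  assumes pvmd: "PvMD R"
begin

text \<open>\<open>R\<^sub>P\<close> contains the valuation ring \<open>R\<^sub>M\<close> for a
  maximal t-ideal \<open>M\<close> above \<open>P\<close>, and a denominator outside
  \<open>M\<close> is also outside \<open>P\<close>.\<close>

lemma t_prime_valuation:
  fixes a b :: 'a
  assumes P: "t_prime P"
  obtains s where "s \<notin> P" "b dvd s * a \<or> a dvd s * b"
proof -
  obtain M where M: "t_maximal M" "t_prime M" "P \<subseteq> M" by (rule t_prime_in_t_maximal[OF P])
  have "\<exists>s. s \<notin> M \<and> (b dvd s * a \<or> a dvd s * b)"
  proof (cases "a = 0 \<or> b = 0")
    case True
    then show ?thesis using t_prime_simps(5)[OF M(2)] by (intro exI[of _ 1]) auto
  next
    case False
    then have "emb a / emb b \<noteq> 0" by simp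
    then have "emb a / emb b \<in> loc M \<or> emb b / emb a \<in> loc M"
      using pvmd M(1) unfolding PvMD_def valuation_domain_def by (metis inverse_divide)
    then show ?thesis using False t_prime_simps(4)[OF M(2)]
      by (simp add: emb_div_in_loc_iff) blast
  qed
  with M(3) that show ?thesis by blast
qed

text \<open>In a valuation ring a finite set generates a principal ideal; the induction compares
  each new element with the generator found so far and multiplies the denominators.\<close>

lemma t_prime_finite_valuation:
  fixes F :: "'a set"
  assumes P: "t_prime P" and F: "finite F" "F \<noteq> {}"
  obtains f s where "f \<in> F" "s \<notin> P" "\<And>g. g \<in> F \<Longrightarrow> f dvd s * g"
proof -
  have "\<exists>f\<in>F. \<exists>s. s \<notin> P \<and> (\<forall>g\<in>F. f dvd s * g)"
    using F
  proof (induction rule: finite_ne_induct)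
    case (singleton x)
    show ?case using t_prime_simps(5)[OF P] by (intro bexI[of _ x] exI[of _ 1]) simp_all
  next
    case (insert x F)
    then obtain f s where f: "f \<in> F" "s \<notin> P" "\<forall>g\<in>F. f dvd s * g" by blast
    obtain r where r: "r \<notin> P" "x dvd r * f \<or> f dvd r * x" by (rule t_prime_valuation[OF P])
    have rs: "r * s \<notin> P" using r f t_prime_simps(7)[OF P] by simp
    from r(2) show ?case
    proof
      assume x: "x dvd r * f"
      have "x dvd (r * s) * g" if "g \<in> F" for g
        using dvd_trans[OF x, of "r * (s * g)"] f(3) that
        by (metis dvd_refl mult.assoc mult_dvd_mono)
      with rs show ?thesis by (intro bexI[of _ x] exI[of _ "r * s"]) auto
    next
      assume x: "f dvd r * x"
      have "f dvd (r * s) * x" using x by (metis dvd_mult mult.assoc mult.commute)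
      moreover have "f dvd (r * s) * g" if "g \<in> F" for g
        using f(3) that by (metis dvd_mult mult.assoc)
      ultimately show ?thesis
        using rs f(1) by (intro bexI[of _ f] exI[of _ "r * s"]) simp_all
    qed
  qed
  with that show ?thesis by blast
qed

text \<open>If \<open>f\<close> generates \<open>F R\<^sub>P\<close> with common denominator
  \<open>s\<close>, then \<open>s/f\<close> maps \<open>F\<close> into \<open>R\<close>, hence also
  maps the v-closure of \<open>F\<close> into \<open>R\<close>.\<close>

lemma in_v_localize:
  assumes P: "t_prime (P :: 'a set)" and F: "finite F" "\<not> F \<subseteq> {0}" and x: "in_v F x"
  obtains f s where "f \<in> F" "s \<notin> P" "f dvd s * x"
proof -
  have "F \<noteq> {}" using F by auto
  then obtain f s where f: "f \<in> F" "s \<notin> P" "\<And>g. g \<in> F \<Longrightarrow> f dvd s * g"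
    using t_prime_finite_valuation[OF P F(1)] by blast
  have "f \<noteq> 0"
  proof
    assume "f = 0"
    then have "s * g = 0" if "g \<in> F" for g using f(3)[OF that] by simp
    moreover have "s \<noteq> 0" using f(2) t_prime_simps(4)[OF P] by auto
    ultimately show False using F(2) by auto
  qed
  then have "f dvd s * x" using x f(3) unfolding in_v_def by blast
  with f that show ?thesis by blast
qed

text \<open>An element of the v-closure of a finite subset of \<open>Q\<close> is carried into
  \<open>Q\<close> by some \<open>s \<notin> P\<close>, and such an \<open>s\<close> cancels in the
  prime \<open>Q\<close>.\<close>

lemma t_prime_subprime:
  assumes P: "t_prime (P :: 'a set)" and Q: "is_prime_ideal Q" "Q \<noteq> {0}" "Q \<subseteq> P"
  shows "t_prime Q"
proof -
  have id: "is_ideal Q" using Q by (simp add: is_prime_ideal_def)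
  obtain a where a: "a \<in> Q" "a \<noteq> 0" using Q ideal_0[OF id] by blast
  have "x \<in> Q" if F: "finite F" "F \<subseteq> Q" "in_v F x" for F x
  proof -
    have "in_v (insert a F) x" by (rule in_v_mono[OF F(3)]) auto
    then obtain f s where f: "f \<in> insert a F" "s \<notin> P" "f dvd s * x"
      using in_v_localize[OF P, of "insert a F"] F a by auto
    then have "s * x \<in> Q" using ideal_dvd[OF id _ f(3)] a F by auto
    then show ?thesis using f Q unfolding is_prime_ideal_def by blast
  qed
  then show ?thesis using Q id by (auto simp: t_prime_def t_ideal_iff)
qed

text \<open>The primes of the valuation ring \<open>R\<^sub>M\<close> form a chain.\<close>

lemma t_primes_comparable:
  assumes M: "t_prime (M :: 'a set)" and P: "t_prime P" "P \<subseteq> M" and Q: "t_prime Q" "Q \<subseteq> M"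
  shows "P \<subseteq> Q \<or> Q \<subseteq> P"
proof (rule ccontr)
  assume "\<not> ?thesis"
  then obtain a b where ab: "a \<in> P" "a \<notin> Q" "b \<in> Q" "b \<notin> P" by auto
  obtain s where s: "s \<notin> M" "b dvd s * a \<or> a dvd s * b" by (rule t_prime_valuation[OF M])
  then have "s * a \<in> Q \<or> s * b \<in> P" using ab P Q t_prime_dvd by blast
  then show False
    using ab s P Q by (auto simp: t_prime_simps(7))
qed

text \<open>In terms of localizations, the following two facts say that \<open>P R\<^sub>P\<close> is contained
  in \<open>R\<^sub>N\<close> for all t-primes \<open>P \<subseteq> N\<close>.\<close>

lemma t_prime_divided:
  assumes N: "t_prime (N :: 'a set)" and P: "t_prime P" "P \<subseteq> N" and p: "p \<in> P" and s: "s \<notin> P"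
  obtains r where "r \<notin> N" "s dvd r * p"
proof -
  obtain r where r: "r \<notin> N" "s dvd r * p \<or> p dvd r * s" by (rule t_prime_valuation[OF N])
  have "\<not> p dvd r * s"
  proof
    assume "p dvd r * s"
    then have "r * s \<in> P" using P p t_prime_dvd by blast
    with s r P show False by (auto simp: t_prime_simps(7))
  qed
  with r that show ?thesis by blast
qed

lemma t_prime_divided_finite:
  assumes N: "t_prime (N :: 'a set)" and P: "t_prime P" "P \<subseteq> N"
    and F: "finite F" "F \<subseteq> P" and s: "s \<notin> P"
  obtains r where "r \<notin> N" "\<And>p. p \<in> F \<Longrightarrow> s dvd r * p"
proof -
  have "\<exists>r. r \<notin> N \<and> s dvd r * p" if "p \<in> F" for p
    using t_prime_divided[OF N P _ s] F that by blast
  then obtain r where r: "\<And>p. p \<in> F \<Longrightarrow> r p \<notin> N" "\<And>p. p \<in> F \<Longrightarrow> s dvd r p * p" by metis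
  have "prod r F \<notin> N" using t_prime_prod_notin[OF N] r by blast
  moreover have "s dvd prod r F * p" if "p \<in> F" for p
  proof -
    have "r p * p dvd prod r F * p" using that F(1) by (intro mult_dvd_mono dvd_prodI dvd_refl)
    with r(2)[OF that] show ?thesis by (rule dvd_trans)
  qed
  ultimately show ?thesis using that by blast
qed

text \<open>The formula \<open>I\<^sub>t = \<Inter>\<^sub>M I R\<^sub>M\<close>. One inclusion is
  the localization of v-closures at valuation rings, the other is comaximality of the
  denominators.\<close>

lemma tcl_iff:
  assumes A: "is_ideal (A :: 'a set)" "A \<noteq> {0}"
  shows "x \<in> tcl A \<longleftrightarrow> (\<forall>M. t_maximal M \<longrightarrow> (\<exists>s. s \<notin> M \<and> s * x \<in> A))"
proof (intro iffI allI impI)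
  fix M :: "'a set" assume x: "x \<in> tcl A" and M: "t_maximal M"
  obtain F where F: "finite F" "F \<subseteq> A" "\<not> F \<subseteq> {0}" "in_v F x" using x by (auto simp: tcl_def)
  obtain f s where f: "f \<in> F" "s \<notin> M" "f dvd s * x"
    by (rule in_v_localize[OF t_maximal_prime[OF M] F(1,3,4)])
  then show "\<exists>s. s \<notin> M \<and> s * x \<in> A" using F ideal_dvd[OF A(1)] by blast
next
  assume "\<forall>M. t_maximal M \<longrightarrow> (\<exists>s. s \<notin> M \<and> s * x \<in> A)"
  then show "x \<in> tcl A" by (intro in_tcl_if_locally[OF A]) auto
qed

lemma t_ideal_tcl_eq: "t_ideal (I :: 'a set) \<Longrightarrow> tcl I = I"
  using tcl_superset[of I] by (auto simp: t_ideal_iff tcl_def)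

lemma t_ideal_local:
  assumes "t_ideal (I :: 'a set)" "x \<notin> I"
  obtains M where "t_maximal M" "\<And>s. s \<notin> M \<Longrightarrow> s * x \<notin> I"
proof -
  have "is_ideal I" "I \<noteq> {0}" using assms(1) by (auto simp: t_ideal_iff)
  then have "\<not> (\<forall>M. t_maximal M \<longrightarrow> (\<exists>s. s \<notin> M \<and> s * x \<in> I))"
    using assms tcl_iff[of I x] t_ideal_tcl_eq[of I] by simp
  with that show ?thesis by blast
qed

text \<open>Radicals of proper ideals in the valuation ring \<open>R\<^sub>M\<close> are prime. Its
  contraction is a nonzero prime inside the t-prime \<open>M\<close>, hence a t-prime.\<close>

lemma loc_rad_t_prime:
  assumes M: "t_prime (M :: 'a set)" and T: "is_ideal T" "T \<noteq> {0}" "T \<subseteq> M"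
  shows "t_prime (loc_rad T M)" "T \<subseteq> loc_rad T M" "loc_rad T M \<subseteq> M"
proof -
  let ?P = "loc_rad T M"
  note mult_notin = t_prime_simps(7)[OF M]
  show TP: "T \<subseteq> ?P"
  proof
    fix x assume "x \<in> T"
    then show "x \<in> ?P" unfolding loc_rad_def using t_prime_simps(5)[OF M]
      by (intro CollectI exI[of _ 1] exI[of _ 0]) auto
  qed
  show PM: "?P \<subseteq> M"
  proof
    fix y assume "y \<in> ?P"
    then obtain s n where "s \<notin> M" "s * y ^ Suc n \<in> M" using T by (auto simp: loc_rad_def)
    then show "y \<in> M" by (simp add: mult_notin t_prime_simps(8)[OF M] del: power_Suc)
  qed
  have cancel: "y \<in> ?P" if s: "s \<notin> M" "s * y ^ n \<in> ?P" for s y n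
  proof -
    obtain r m where r: "r \<notin> M" "r * (s * y ^ n) ^ Suc m \<in> T"
      using s(2) unfolding loc_rad_def by blast
    \<comment> \<open>The spare factor \<open>y\<close> keeps the exponent positive even for
      \<open>n = 0\<close>.\<close>
    have "(r * s ^ Suc m) * y ^ Suc (n * Suc m) = y * (r * (s * y ^ n) ^ Suc m)"
      by (simp only: power_mult_distrib power_mult power_Suc[of y] ac_simps)
    also have "\<dots> \<in> T" using r(2) by (rule ideal_multl[OF T(1)])
    finally have "(r * s ^ Suc m) * y ^ Suc (n * Suc m) \<in> T" .
    moreover have "r * s ^ Suc m \<notin> M"
      using r s t_prime_power_notin[OF M] mult_notin by blast
    ultimately show ?thesis unfolding loc_rad_def by blast
  qed
  have dvd: "y \<in> ?P" if x: "x \<in> ?P" "x dvd y" for x y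
  proof -
    obtain s n where s: "s \<notin> M" "s * x ^ Suc n \<in> T" using x(1) unfolding loc_rad_def by blast
    have "s * x ^ Suc n dvd s * y ^ Suc n"
      using x(2) by (intro mult_dvd_mono dvd_power_same dvd_refl)
    with s have "s * y ^ Suc n \<in> T" using ideal_dvd[OF T(1)] by blast
    with s show ?thesis unfolding loc_rad_def by blast
  qed
  have "is_prime_ideal ?P" unfolding is_prime_ideal_def is_ideal_def
  proof (intro conjI ballI allI impI)
    show "0 \<in> ?P" using TP ideal_0[OF T(1)] by blast
    show "?P \<noteq> UNIV" using PM t_prime_simps(2)[OF M] by blast
  next
    fix x y assume xy: "x \<in> ?P" "y \<in> ?P"
    have *: "x + y \<in> ?P" if "x \<in> ?P" "s \<notin> M" "x dvd s * y" for x y s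
    proof -
      have "x dvd s * (x + y)" using that(3) by (simp add: distrib_left)
      then have "s * (x + y) ^ 1 \<in> ?P" using dvd[OF that(1)] by simp
      with that(2) show ?thesis by (rule cancel)
    qed
    obtain s where "s \<notin> M" "y dvd s * x \<or> x dvd s * y" by (rule t_prime_valuation[OF M])
    then show "x + y \<in> ?P" using *[of x s y] *[of y s x] xy add.commute[of x y] by metis
  next
    fix r x assume "x \<in> ?P"
    then show "r * x \<in> ?P" by (rule dvd) simp
  next
    fix a b assume ab: "a * b \<in> ?P"
    \<comment> \<open>When \<open>a\<close> divides \<open>b\<close> locally, \<open>a * b\<close>
      divides \<open>b ^ 2\<close> locally, so the radical contains the multiple
      \<open>b\<close>.\<close>
    have *: "b \<in> ?P" if "a * b \<in> ?P" "s \<notin> M" "a dvd s * b" for a b s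
    proof -
      have "a * b dvd (s * b) * b" using that(3) by (intro mult_dvd_mono dvd_refl)
      then have "s * b ^ 2 \<in> ?P" using dvd[OF that(1)] by (simp add: power2_eq_square mult.assoc)
      with that(2) show ?thesis by (rule cancel)
    qed
    obtain s where "s \<notin> M" "b dvd s * a \<or> a dvd s * b" by (rule t_prime_valuation[OF M])
    then show "a \<in> ?P \<or> b \<in> ?P" using *[of a b s] *[of b a s] ab mult.commute[of a b] by metis
  qed
  then show "t_prime ?P"
    using PM TP T ideal_0[OF T(1)] by (intro t_prime_subprime[OF M]) auto
qed

text \<open>Take \<open>P\<close> to be \<open>loc_rad I M\<close> for a maximal t-ideal
  \<open>M\<close> at which membership of \<open>x\<close> in \<open>I\<close> fails; radicality of
  \<open>I\<close> keeps \<open>x\<close> out of it.\<close>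

lemma radical_t_ideal_separate:
  assumes I: "t_ideal (I :: 'a set)" "rad I = I" and x: "x \<notin> I"
  obtains P where "t_prime P" "I \<subseteq> P" "x \<notin> P"
proof -
  obtain M where M: "t_maximal M" "\<And>s. s \<notin> M \<Longrightarrow> s * x \<notin> I"
    using t_ideal_local[OF I(1) x] by blast
  note tM = t_maximal_prime[OF M(1)]
  have "I \<subseteq> M" using M(2) ideal_multr[OF t_ideal_ideal[OF I(1)]] by blast
  note P = loc_rad_t_prime[OF tM t_ideal_ideal[OF I(1)] _ this]
  have "x \<notin> loc_rad I M"
  proof
    assume "x \<in> loc_rad I M"
    then obtain s n where s: "s \<notin> M" "s * x ^ Suc n \<in> I" by (auto simp: loc_rad_def)
    have "(s * x) ^ Suc n = s ^ n * (s * x ^ Suc n)" by (simp add: power_mult_distrib ac_simps)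
    also have "\<dots> \<in> I" using s(2) by (rule ideal_multl[OF t_ideal_ideal[OF I(1)]])
    finally have "(s * x) ^ Suc n \<in> I" .
    then have "s * x \<in> rad I" unfolding rad_def by blast
    with I(2) M(2)[OF s(1)] show False by simp
  qed
  moreover have "I \<noteq> {0}" using I by (simp add: t_ideal_iff)
  ultimately show ?thesis using that P by blast
qed

section \<open>Branched primes and the ascending chain condition on t-primes\<close>

text \<open>The t-primes properly inside \<open>P\<close> form a chain, so the chain condition gives
  a largest one if any exist; an element of \<open>P\<close> outside it works.\<close>

lemma acc_t_prime_minimal_over:
  assumes acc: "acc {P :: 'a set. t_prime P}" and P: "t_prime (P :: 'a set)"
  obtains a where "a \<in> P" "a \<noteq> 0" "\<And>Q. t_prime Q \<Longrightarrow> Q \<subseteq> P \<Longrightarrow> a \<in> Q \<Longrightarrow> Q = P"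
proof (cases "\<exists>Q. t_prime Q \<and> Q \<subset> P")
  case False
  obtain a where "a \<in> P" "a \<noteq> 0" using t_ideal_nonzero t_prime_simps(3)[OF P] by blast
  with False that show ?thesis by blast
next
  case True
  then obtain Q0 where Q0: "Q0 \<in> {Q. t_prime Q \<and> Q \<subset> P}" by blast
  have "\<exists>Q\<in>{Q. t_prime Q \<and> Q \<subset> P}. Q0 \<subseteq> Q \<and>
      (\<forall>Q'\<in>{Q. t_prime Q \<and> Q \<subset> P}. Q \<subseteq> Q' \<longrightarrow> Q' = Q)"
    by (rule acc_maximal[OF acc _ Q0]) auto
  then obtain Q where Q: "t_prime Q" "Q \<subset> P"
    and max: "\<And>Q'. t_prime Q' \<Longrightarrow> Q' \<subset> P \<Longrightarrow> Q \<subseteq> Q' \<Longrightarrow> Q' = Q"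
    by (elim bexE conjE CollectE) simp
  obtain a where a: "a \<in> P" "a \<notin> Q" using Q by blast
  have "Q' = P" if Q': "t_prime Q'" "Q' \<subseteq> P" "a \<in> Q'" for Q'
  proof (rule ccontr)
    assume "Q' \<noteq> P"
    then have "Q' \<subset> P" using Q' by blast
    moreover have "Q \<subseteq> Q' \<or> Q' \<subseteq> Q" using Q Q' by (intro t_primes_comparable[OF P]) auto
    ultimately show False using max[OF Q'(1)] Q'(3) a(2) by blast
  qed
  moreover have "a \<noteq> 0" using a t_prime_simps(4)[OF Q(1)] by auto
  ultimately show ?thesis using that a by blast
qed

text \<open>The contraction \<open>b R\<^sub>P \<inter> R\<close> of a principal ideal.\<close>

definition contr :: "'a \<Rightarrow> 'a set \<Rightarrow> 'a set" where
  "contr b P = {y. \<exists>s. s \<notin> P \<and> b dvd s * y}"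

lemma ideal_contr:
  assumes P: "t_prime P"
  shows "is_ideal (contr b P)"
  unfolding is_ideal_def contr_def
proof (intro conjI ballI allI impI CollectI; (elim CollectE exE conjE)?)
  show "\<exists>s. s \<notin> P \<and> b dvd s * 0"
    using t_prime_simps(5)[OF P] by (intro exI[of _ 1]) simp
next
  fix x y s r assume "s \<notin> P" "b dvd s * x" "r \<notin> P" "b dvd r * y"
  moreover from this have "b dvd r * (s * x)" "b dvd s * (r * y)" by simp_all
  then have "b dvd r * s * (x + y)" by (simp add: distrib_left ac_simps)
  ultimately show "\<exists>s. s \<notin> P \<and> b dvd s * (x + y)"
    using t_prime_simps(7)[OF P] by blast
next
  fix r x s assume s: "s \<notin> P" "b dvd s * x"
  then have "b dvd r * (s * x)" by simp
  then have "b dvd s * (r * x)" by (simp add: ac_simps)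
  with s show "\<exists>s. s \<notin> P \<and> b dvd s * (r * x)" by blast
qed

lemma contr_member: "t_prime P \<Longrightarrow> b \<in> contr b P"
  unfolding contr_def using t_prime_simps(5) by (intro CollectI exI[of _ 1]) simp

text \<open>The radical is the t-prime \<open>loc_rad T P\<close> for \<open>T\<close> the multiples
  of \<open>a * a\<close>; it contains \<open>a\<close>, so minimality identifies it with
  \<open>P\<close>.\<close>

lemma rad_contr:
  assumes P: "t_prime P" and a: "a \<in> P" "a \<noteq> 0"
    and min: "\<And>Q. t_prime Q \<Longrightarrow> Q \<subseteq> P \<Longrightarrow> a \<in> Q \<Longrightarrow> Q = P"
  shows "rad (contr (a * a) P) = P"
proof -
  define T where "T = {y. a * a dvd y}"
  have T: "is_ideal T" "T \<noteq> {0}" "T \<subseteq> P"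
  proof -
    show "is_ideal T" by (simp add: is_ideal_def T_def)
    have "a * a \<in> T" by (simp add: T_def)
    then show "T \<noteq> {0}" using a by auto
    show "T \<subseteq> P" using a t_prime_dvd[OF P] t_prime_simps(7)[OF P] unfolding T_def by blast
  qed
  have "a * a \<in> T" by (simp add: T_def)
  then have "a * a \<in> loc_rad T P" using loc_rad_t_prime(2)[OF P T] by blast
  then have "a \<in> loc_rad T P" using t_prime_simps(7)[OF loc_rad_t_prime(1)[OF P T]] by blast
  then have "loc_rad T P = P" using loc_rad_t_prime[OF P T] by (intro min)
  moreover have "rad (contr (a * a) P) = loc_rad T P"
    by (simp add: rad_def contr_def loc_rad_def T_def) blast
  ultimately show ?thesis by simp
qed

text \<open>Otherwise \<open>a\<close> would be a unit in \<open>R\<^sub>P\<close>.\<close>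

lemma contr_square_notin:
  assumes P: "t_prime P" and a: "a \<in> P" "a \<noteq> 0"
  shows "a \<notin> contr (a * a) P"
proof
  assume "a \<in> contr (a * a) P"
  then obtain s where s: "s \<notin> P" "a * a dvd s * a" unfolding contr_def by blast
  then have "a dvd s" using a(2) by (metis dvd_mult_cancel_right)
  with s a P t_prime_dvd show False by blast
qed

text \<open>For \<open>P\<close> minimal over \<open>a\<close>, the contraction of
  \<open>a * a\<close> is \<open>P\<close>-primary, since elements outside \<open>P\<close> are
  units in \<open>R\<^sub>P\<close>, and it omits \<open>a\<close>.\<close>

lemma acc_imp_branched:
  assumes acc: "acc {P :: 'a set. t_prime P}" and P: "t_prime (P :: 'a set)"
  shows "branched P"
proof -
  obtain a where a: "a \<in> P" "a \<noteq> 0" "\<And>Q. t_prime Q \<Longrightarrow> Q \<subseteq> P \<Longrightarrow> a \<in> Q \<Longrightarrow> Q = P"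
    using acc_t_prime_minimal_over[OF acc P] by blast
  let ?Q = "contr (a * a) P"
  have r: "rad ?Q = P" by (rule rad_contr[OF P a])
  have n: "a \<notin> ?Q" by (rule contr_square_notin[OF P a(1,2)])
  have "x \<in> ?Q \<or> y \<in> rad ?Q" if xy: "x * y \<in> ?Q" for x y
  proof (cases "y \<in> P")
    case False
    obtain s where s: "s \<notin> P" "a * a dvd s * (x * y)" using xy unfolding contr_def by blast
    then have "a * a dvd (s * y) * x" by (simp add: ac_simps)
    moreover have "s * y \<notin> P" using s False t_prime_simps(7)[OF P] by blast
    ultimately show ?thesis unfolding contr_def by blast
  qed (simp add: r)
  then have "is_primary ?Q" using n ideal_contr[OF P] unfolding is_primary_def by blast
  with r n a(1) show ?thesis unfolding branched_def by blast
qed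

lemma t_prime_Union_increasing:
  fixes f :: "nat \<Rightarrow> 'a set"
  assumes f: "\<And>n. t_prime (f n)" "mono f"
  shows "t_prime (\<Union>n. f n)"
proof -
  have "t_ideal (\<Union>(range f))"
  proof (rule t_ideal_Union_chain)
    show "X \<subseteq> Y \<or> Y \<subseteq> X" if "X \<in> range f" "Y \<in> range f" for X Y
      using mono_range_chain[OF f(2) that] .
  qed (use f t_prime_simps(3) in auto)
  moreover from this have "is_ideal (\<Union>(range f))" by (rule t_ideal_ideal)
  moreover have "\<Union>(range f) \<noteq> UNIV"
  proof -
    have "1 \<notin> \<Union>(range f)" using t_prime_simps(5)[OF f(1)] by simp
    then show ?thesis by auto
  qed
  moreover have "a \<in> \<Union>(range f) \<or> b \<in> \<Union>(range f)" if ab: "a * b \<in> \<Union>(range f)" for a b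
  proof -
    obtain n where "a * b \<in> f n" using ab by auto
    then have "a \<in> f n \<or> b \<in> f n" by (simp add: t_prime_simps(7)[OF f(1)])
    then show ?thesis by auto
  qed
  ultimately show ?thesis by (simp add: t_prime_def is_prime_ideal_def)
qed

text \<open>The union \<open>P\<close> of the chain is branched, say by \<open>Q\<close>. Pick
  \<open>x \<in> P\<close> outside \<open>Q\<close>, lying in \<open>f N\<close>. An element
  \<open>y\<close> of \<open>P\<close> outside \<open>f N\<close> would have a power in
  \<open>Q\<close> dividing \<open>x\<close> in \<open>R\<^sub>P\<close>, forcing
  \<open>x \<in> Q\<close>; so the chain stops at \<open>N\<close>.\<close>

lemma branched_imp_acc:
  assumes br: "\<And>P :: 'a set. t_prime P \<Longrightarrow> branched P"
  shows "acc {P :: 'a set. t_prime P}"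
  unfolding acc_def
proof (intro allI impI, elim conjE)
  fix f :: "nat \<Rightarrow> 'a set"
  assume f0: "\<forall>n. f n \<in> {P. t_prime P}" and inc: "\<forall>n. f n \<subseteq> f (Suc n)"
  have f: "t_prime (f n)" for n using f0 by simp
  have mono: "mono f" using inc by (simp add: mono_iff_le_Suc)
  define P where "P = (\<Union>n. f n)"
  have P: "t_prime P" unfolding P_def by (rule t_prime_Union_increasing[OF f mono])
  obtain Q where Q: "is_primary Q" "rad Q = P" "Q \<noteq> P" using br[OF P] by (auto simp: branched_def)
  have idQ: "is_ideal Q" using Q by (simp add: is_primary_def)
  have "Q \<subseteq> P"
  proof
    fix q assume "q \<in> Q"
    then have "q ^ Suc 0 \<in> Q" by simp
    then show "q \<in> P" using Q(2) unfolding rad_def by blast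
  qed
  then obtain x where x: "x \<in> P" "x \<notin> Q" using Q by blast
  then obtain N where N: "x \<in> f N" by (auto simp: P_def)
  have "P \<subseteq> f N"
  proof
    fix y assume y: "y \<in> P"
    show "y \<in> f N"
    proof (rule ccontr)
      assume yN: "y \<notin> f N"
      obtain k where k: "y ^ Suc k \<in> Q" using y Q(2) by (auto simp: rad_def)
      have "y ^ Suc k \<notin> f N" using yN by (rule t_prime_power_notin[OF f])
      moreover have "f N \<subseteq> P" by (auto simp: P_def)
      ultimately obtain r where r: "r \<notin> P" "y ^ Suc k dvd r * x"
        using t_prime_divided[OF P f _ N] by blast
      then have "x * r \<in> Q" using ideal_dvd[OF idQ k] by (simp add: mult.commute)
      then show False using Q x r unfolding is_primary_def by blast
    qed
  qed
  then have "f n = f N" if "n \<ge> N" for n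
    using monoD[OF mono that] by (auto simp: P_def)
  then show "\<exists>N. \<forall>n\<ge>N. f n = f N" by blast
qed

section \<open>t-primes that are radicals of v-finite ideals\<close>

lemma t_finite_if_separated:
  fixes c d :: 'a
  assumes P: "t_prime P" and d: "d \<noteq> 0" and no: "\<And>s. s \<notin> P \<Longrightarrow> \<not> d dvd s * c"
    and sep: "\<And>Q. t_prime Q \<Longrightarrow> \<not> P \<subseteq> Q \<Longrightarrow> \<exists>s. s \<notin> Q \<and> d dvd s * c"
  shows "t_finite P"
proof -
  txt \<open>With \<open>u = c/d\<close> and \<open>D = (R : u) \<inter> R\<close>, the ideal \<open>L = D (1, u)\<close> lies in no maximal
    t-ideal; the coefficients occurring in finitely many elements of \<open>L\<close> with v-closure \<open>R\<close>
    form the required finite subset of \<open>D \<subseteq> P\<close>.\<close>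
  define L where "L = {z. \<exists>r r'. d dvd r * c \<and> d dvd r' * c \<and> d * z = d * r + r' * c}"
  have L1: "is_ideal L" unfolding is_ideal_def
  proof (intro conjI ballI allI impI)
    show "0 \<in> L" unfolding L_def by (intro CollectI exI[of _ 0]) simp
  next
    fix x y assume "x \<in> L" "y \<in> L"
    then obtain r r' q q' where "d dvd r * c" "d dvd r' * c" "d * x = d * r + r' * c"
      "d dvd q * c" "d dvd q' * c" "d * y = d * q + q' * c" unfolding L_def by blast
    then show "x + y \<in> L" unfolding L_def
      by (intro CollectI exI[of _ "r + q"] exI[of _ "r' + q'"]) (simp add: algebra_simps)
  next
    fix t x assume "x \<in> L"
    then obtain r r' where r: "d dvd r * c" "d dvd r' * c" "d * x = d * r + r' * c"
      unfolding L_def by blast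
    have "d * (t * x) = t * (d * x)" by (simp add: ac_simps)
    also have "\<dots> = d * (t * r) + (t * r') * c" by (simp add: r(3) algebra_simps)
    finally show "t * x \<in> L" unfolding L_def using r(1,2)
      by (intro CollectI exI[of _ "t * r"] exI[of _ "t * r'"]) (simp add: mult.assoc)
  qed
  have L2: "L \<noteq> {0}"
  proof -
    have "d \<in> L" unfolding L_def by (intro CollectI exI[of _ d] exI[of _ 0]) simp
    then show ?thesis using d by blast
  qed
  have L3: "\<not> L \<subseteq> M" if M: "t_maximal M" for M
  proof -
    obtain s where s: "s \<notin> M" "d dvd s * c \<or> c dvd s * d"
      by (rule t_prime_valuation[OF t_maximal_prime[OF M]])
    \<comment> \<open>If \<open>s u \<in> R\<close>, then \<open>s\<close> arises from the
      coefficient of \<open>1\<close>; otherwise \<open>s = e u\<close> with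
      \<open>e \<in> D\<close>.\<close>
    from s(2) have "s \<in> L"
    proof
      assume "d dvd s * c"
      then show ?thesis unfolding L_def by (intro CollectI exI[of _ s] exI[of _ 0]) simp
    next
      assume "c dvd s * d"
      then obtain e where "s * d = c * e" unfolding dvd_def by blast
      then have e: "e * c = d * s" by (simp add: mult.commute)
      show ?thesis unfolding L_def by (intro CollectI exI[of _ 0] exI[of _ e]) (simp add: e)
    qed
    with s show ?thesis by blast
  qed
  obtain F where F: "finite F" "F \<subseteq> L" "\<not> F \<subseteq> {0}" "in_v F 1"
    by (rule comaximal_in_v_1[OF L1 L2 L3])
  have "\<forall>z\<in>F. \<exists>r r'. d dvd r * c \<and> d dvd r' * c \<and> d * z = d * r + r' * c"
    using F(2) unfolding L_def by blast
  then obtain r r' where r: "\<And>z. z \<in> F \<Longrightarrow> d dvd r z * c" "\<And>z. z \<in> F \<Longrightarrow> d dvd r' z * c"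
      "\<And>z. z \<in> F \<Longrightarrow> d * z = d * r z + r' z * c" by metis
  let ?J = "r ` F \<union> r' ` F"
  have "?J \<subseteq> P" using no r(1,2) by blast
  moreover have "P \<subseteq> Q" if Q: "t_prime Q" and JQ: "?J \<subseteq> Q" for Q
  proof (rule ccontr)
    assume "\<not> P \<subseteq> Q"
    \<comment> \<open>Here \<open>s u = k\<close> lies in \<open>R\<close>, so \<open>s z\<close> is
      a combination over \<open>R\<close> of the coefficients of \<open>z\<close>; this pushes
      \<open>F\<close>, and then \<open>1\<close>, into \<open>Q\<close>.\<close>
    with sep[OF Q] obtain s k where s: "s \<notin> Q" "s * c = d * k" unfolding dvd_def by blast
    have "z \<in> Q" if z: "z \<in> F" for z
    proof -
      have "d * (s * z) = s * (d * z)" by (simp add: ac_simps)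
      also have "\<dots> = d * (s * r z) + r' z * (s * c)" by (simp add: r(3)[OF z] algebra_simps)
      also have "\<dots> = d * (s * r z + r' z * k)" by (subst s(2)) (simp add: algebra_simps)
      finally have "s * z = s * r z + r' z * k" using d by simp
      moreover have "r z \<in> Q" "r' z \<in> Q" using JQ z by auto
      ultimately have "s * z \<in> Q"
        using t_prime_simps(1)[OF Q] by (simp add: ideal_add ideal_multl ideal_multr)
      with s show ?thesis using t_prime_simps(7)[OF Q] by blast
    qed
    then have "F \<subseteq> Q" by blast
    then have "1 \<in> Q" by (rule t_ideal_in_v[OF t_prime_simps(3)[OF Q] F(1) _ F(4)])
    with t_prime_simps(5)[OF Q] show False by blast
  qed
  ultimately show ?thesis using F(1) unfolding t_finite_def by (intro exI[of _ ?J]) auto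
qed

lemma t_finite_nonzero:
  assumes P: "t_prime (P :: 'a set)" "t_finite P"
  obtains F where "finite F" "F \<subseteq> P" "\<not> F \<subseteq> {0}"
    "\<And>Q. t_prime Q \<Longrightarrow> F \<subseteq> Q \<Longrightarrow> P \<subseteq> Q"
proof -
  obtain F where F: "finite F" "F \<subseteq> P" "\<forall>Q. t_prime Q \<longrightarrow> F \<subseteq> Q \<longrightarrow> P \<subseteq> Q"
    using P(2) unfolding t_finite_def by blast
  obtain a where a: "a \<in> P" "a \<noteq> 0" using t_ideal_nonzero[OF t_prime_simps(3)[OF P(1)]] .
  show ?thesis
  proof (rule that[of "insert a F"])
    show "P \<subseteq> Q" if "t_prime Q" "insert a F \<subseteq> Q" for Q using F(3) that by simp
  qed (use F a in simp_all)
qed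

subsection \<open>The t##-property\<close>

text \<open>If \<open>f\<close> generates \<open>F R\<^sub>P\<close>, then \<open>s/f\<close> lies
  in \<open>(R : F)\<close>, hence in \<open>R\<^sub>Q\<close> whenever \<open>F\<close> is not
  inside \<open>Q\<close>. It is not in \<open>R\<^sub>P\<close>, because \<open>f \<in> P\<close>
  and \<open>s \<notin> P\<close>.\<close>

lemma t_finite_loc_Inter:
  assumes P: "t_prime (P :: 'a set)" "t_finite P"
    and S: "\<And>Q. Q \<in> S \<Longrightarrow> t_prime Q" and sub: "(\<Inter>Q\<in>S. loc Q) \<subseteq> loc P"
  shows "\<exists>Q\<in>S. P \<subseteq> Q"
proof (rule ccontr)
  assume no: "\<not> ?thesis"
  obtain F where F: "finite F" "F \<subseteq> P" "\<not> F \<subseteq> {0}"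
    and FQ: "\<And>Q. t_prime Q \<Longrightarrow> F \<subseteq> Q \<Longrightarrow> P \<subseteq> Q"
    using t_finite_nonzero[OF P] by blast
  have "F \<noteq> {}" using F(3) by auto
  then obtain f s where f: "f \<in> F" "s \<notin> P" "\<And>g. g \<in> F \<Longrightarrow> f dvd s * g"
    using t_prime_finite_valuation[OF P(1) F(1)] by blast
  have "s \<noteq> 0" using f(2) t_prime_simps(4)[OF P(1)] by auto
  have "f \<noteq> 0"
  proof
    assume "f = 0"
    then have "g = 0" if "g \<in> F" for g using f(3)[OF that] \<open>s \<noteq> 0\<close> by simp
    with F(3) show False by auto
  qed
  have "emb s / emb f \<in> loc Q" if Q: "Q \<in> S" for Q
  proof -
    have "\<not> F \<subseteq> Q" using FQ[OF S[OF Q]] no Q by blast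
    then obtain g where "g \<in> F" "g \<notin> Q" by blast
    moreover have "f dvd g * s" using f(3)[OF \<open>g \<in> F\<close>] by (simp add: mult.commute)
    ultimately show ?thesis
      using emb_div_in_loc_iff[OF t_prime_simps(4)[OF S[OF Q]] \<open>f \<noteq> 0\<close>] by blast
  qed
  then have "emb s / emb f \<in> loc P" using sub by blast
  then obtain r where r: "r \<notin> P" "f dvd r * s"
    using emb_div_in_loc_iff[OF t_prime_simps(4)[OF P(1)] \<open>f \<noteq> 0\<close>] by blast
  have "f \<in> P" using f(1) F(2) by blast
  then have "r * s \<in> P" using r(2) by (rule t_prime_dvd[OF P(1)])
  with r f(2) show False by (simp add: t_prime_simps(7)[OF P(1)])
qed

text \<open>Equal intersections place each \<open>P\<close> of one family below some
  \<open>Q\<close> of the other, and \<open>Q\<close> below some \<open>P'\<close> of the first;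
  incomparability gives \<open>P = P'\<close>, hence \<open>P = Q\<close>.\<close>

lemma t_finite_imp_t_sharp_sharp:
  assumes fin: "\<And>P :: 'a set. t_prime P \<Longrightarrow> t_finite P"
  shows "t_sharp_sharp R"
proof -
  have half: "S1 \<subseteq> S2"
    if S1: "\<forall>P\<in>S1. t_prime P" "pairwise_incomparable S1" and S2: "\<forall>P\<in>S2. t_prime P"
      and eq: "(\<Inter>P\<in>S1. loc P) = (\<Inter>P\<in>S2. loc P)"
    for S1 S2 :: "'a set set"
  proof
    fix P assume P: "P \<in> S1"
    have "\<exists>Q\<in>S2. P \<subseteq> Q" using P S1 S2 eq fin
      by (intro t_finite_loc_Inter) auto
    then obtain Q where Q: "Q \<in> S2" "P \<subseteq> Q" by blast
    have "\<exists>P'\<in>S1. Q \<subseteq> P'" using Q S1 S2 eq fin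
      by (intro t_finite_loc_Inter) auto
    then obtain P' where P': "P' \<in> S1" "Q \<subseteq> P'" by blast
    have "P \<subseteq> P'" using Q(2) P'(2) by (rule subset_trans)
    then have "P = P'" using S1(2) P P'(1) unfolding pairwise_incomparable_def by simp
    with Q P' have "P = Q" by simp
    with Q show "P \<in> S2" by simp
  qed
  show ?thesis unfolding t_sharp_sharp_def
  proof (intro allI impI notI, elim conjE)
    fix S1 S2 :: "'a set set"
    assume a: "S1 \<noteq> S2" "\<forall>P\<in>S1. t_prime P" "\<forall>P\<in>S2. t_prime P"
      "pairwise_incomparable S1" "pairwise_incomparable S2"
      and eq: "(\<Inter>P\<in>S1. loc P) = (\<Inter>P\<in>S2. loc P)"
    have "S1 \<subseteq> S2" by (rule half[OF a(2,4,3) eq])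
    moreover have "S2 \<subseteq> S1" by (rule half[OF a(3,5,2) eq[symmetric]])
    ultimately show False using a(1) by simp
  qed
qed

lemma t_sharp_sharp_imp_t_finite:
  assumes tss: "t_sharp_sharp R" and acc: "acc {P :: 'a set. t_prime P}"
    and P: "t_prime (P :: 'a set)"
  shows "t_finite P"
proof -
  txt \<open>Replacing in \<open>S2\<close> the primes inside \<open>P\<close> by \<open>P\<close> itself must change the intersection
    of the localizations.\<close>
  define C where "C = {Q :: 'a set. t_prime Q \<and> \<not> P \<subseteq> Q}"
  define S2 where "S2 = {Q \<in> C. \<forall>Q'\<in>C. Q \<subseteq> Q' \<longrightarrow> Q' = Q}"
  define S1 where "S1 = insert P {Q \<in> S2. \<not> Q \<subseteq> P}"
  have S2: "t_prime Q" "\<not> P \<subseteq> Q" if "Q \<in> S2" for Q using that by (simp_all add: S2_def C_def)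
  \<comment> \<open>The chain condition makes the maximal members of \<open>C\<close> cofinal in it,
    so lying in \<open>loc Q\<close> for \<open>Q \<in> S2\<close> suffices for all of
    \<open>C\<close>.\<close>
  have S2_above: "\<exists>Q'\<in>S2. Q \<subseteq> Q'" if Q: "t_prime Q" "\<not> P \<subseteq> Q" for Q
  proof -
    have "Q \<in> C" using Q by (simp add: C_def)
    moreover have "C \<subseteq> {P. t_prime P}" by (auto simp: C_def)
    ultimately have "\<exists>m\<in>C. Q \<subseteq> m \<and> (\<forall>y\<in>C. m \<subseteq> y \<longrightarrow> y = m)"
      by (intro acc_maximal[OF acc])
    then obtain m where m: "m \<in> C" "Q \<subseteq> m" "\<forall>y\<in>C. m \<subseteq> y \<longrightarrow> y = m" by (elim bexE conjE)
    then have "m \<in> S2" by (simp add: S2_def)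
    with m(2) show ?thesis by blast
  qed
  have inc2: "pairwise_incomparable S2"
    unfolding pairwise_incomparable_def S2_def by simp
  have inc1: "pairwise_incomparable S1"
    unfolding pairwise_incomparable_def S1_def
    using inc2 S2(2) by (simp add: pairwise_incomparable_def)
  have "P \<notin> S2" using S2(2) by blast
  then have "S1 \<noteq> S2" by (auto simp: S1_def)
  moreover have "\<forall>Q\<in>S1. t_prime Q" using S2(1) P by (simp add: S1_def)
  ultimately have ne: "(\<Inter>Q\<in>S1. loc Q) \<noteq> (\<Inter>Q\<in>S2. loc Q)"
    using tss inc1 inc2 S2(1) unfolding t_sharp_sharp_def by simp
  have "(\<Inter>Q\<in>S1. loc Q) \<subseteq> (\<Inter>Q\<in>S2. loc Q)"
  proof (rule INT_greatest)
    fix Q assume Q: "Q \<in> S2"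
    show "(\<Inter>Q\<in>S1. loc Q) \<subseteq> loc Q"
    proof (cases "Q \<subseteq> P")
      case True
      then have "loc P \<subseteq> loc Q" by (rule loc_mono)
      then show ?thesis by (auto simp: S1_def)
    next
      case False
      then have "Q \<in> S1" using Q by (simp add: S1_def)
      then show ?thesis by (rule INT_lower)
    qed
  qed
  \<comment> \<open>The two intersections differ although one contains the other; the discrepancy
    can only come from \<open>P\<close>, so \<open>u\<close> separates \<open>P\<close> from
    \<open>S2\<close>.\<close>
  with ne obtain u where u: "u \<in> (\<Inter>Q\<in>S2. loc Q)" "u \<notin> (\<Inter>Q\<in>S1. loc Q)" by blast
  have uP: "u \<notin> loc P"
  proof
    assume "u \<in> loc P"
    with u(1) have "u \<in> (\<Inter>Q\<in>S1. loc Q)" by (simp add: S1_def)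
    with u(2) show False by simp
  qed
  obtain c d where d: "d \<noteq> 0" "u = emb c / emb d" by (rule fract_cases_emb)
  show ?thesis
  proof (rule t_finite_if_separated[OF P d(1)])
    show "\<not> d dvd s * c" if "s \<notin> P" for s
      using uP that emb_div_in_loc_iff[OF t_prime_simps(4)[OF P] d(1)] unfolding d(2) by blast
    fix Q assume Q: "t_prime Q" "\<not> P \<subseteq> Q"
    obtain Q' where Q': "Q' \<in> S2" "Q \<subseteq> Q'" using S2_above[OF Q] by blast
    have "u \<in> loc Q'" using u(1) Q'(1) by simp
    then have "u \<in> loc Q" using loc_mono[OF Q'(2)] by blast
    then show "\<exists>s. s \<notin> Q \<and> d dvd s * c"
      using emb_div_in_loc_iff[OF t_prime_simps(4)[OF Q(1)] d(1)] unfolding d(2) by blast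
  qed
qed

subsection \<open>The ascending chain condition on radical t-ideals\<close>

lemma t_prime_rad: "t_prime P \<Longrightarrow> rad P = P"
  by (simp only: rad_def t_prime_simps(8)) simp

lemma acc_radical_imp_acc_prime:
  assumes "acc {I :: 'a set. t_ideal I \<and> rad I = I}"
  shows "acc {P :: 'a set. t_prime P}"
proof -
  have "{P :: 'a set. t_prime P} \<subseteq> {I. t_ideal I \<and> rad I = I}"
    by (auto simp: t_prime_simps(3) t_prime_rad)
  then have "f n \<in> {I. t_ideal I \<and> rad I = I}" if "\<forall>n. f n \<in> {P. t_prime P}" for f :: "nat \<Rightarrow> 'a set" and n
    using that by (meson subsetD)
  then show ?thesis using assms unfolding acc_def by simp
qed

lemma Inter_t_primes_radical:
  assumes P: "t_prime (P :: 'a set)" and F: "F \<subseteq> P" "\<not> F \<subseteq> {0}"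
  defines "I \<equiv> \<Inter>{Q. t_prime Q \<and> F \<subseteq> Q}"
  shows "t_ideal I" "rad I = I" "F \<subseteq> I"
proof -
  show FI: "F \<subseteq> I" by (auto simp: I_def)
  have "is_ideal I" unfolding I_def by (rule ideal_Inter) (simp add: t_prime_simps(1))
  moreover have "I \<noteq> {0}" using F(2) FI by auto
  moreover have "x \<in> I" if "finite G" "G \<subseteq> I" "in_v G x" for G x
  proof -
    have "x \<in> Q" if Q: "t_prime Q" "F \<subseteq> Q" for Q
    proof (rule t_ideal_in_v[OF t_prime_simps(3)[OF Q(1)] \<open>finite G\<close> _ \<open>in_v G x\<close>])
      show "G \<subseteq> Q" using \<open>G \<subseteq> I\<close> Q by (auto simp: I_def)
    qed
    then show ?thesis by (simp add: I_def)
  qed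
  ultimately show "t_ideal I" unfolding t_ideal_iff by blast
  have "x \<in> I" if x: "x ^ Suc n \<in> I" for x n
  proof -
    have "x \<in> Q" if Q: "t_prime Q" "F \<subseteq> Q" for Q
    proof -
      have "x ^ Suc n \<in> Q" using x Q unfolding I_def by blast
      then show ?thesis by (simp only: t_prime_simps(8)[OF Q(1)])
    qed
    then show ?thesis by (simp add: I_def)
  qed
  moreover have "x ^ Suc 0 \<in> I" if "x \<in> I" for x using that by simp
  ultimately show "rad I = I" unfolding rad_def by blast
qed

text \<open>Among the radicals \<open>r F\<close> of finite subsets of \<open>P\<close> choose a
  maximal one; adjoining any \<open>x \<in> P\<close> to \<open>F\<close> cannot enlarge it, so it
  contains \<open>P\<close>.\<close>

lemma acc_radical_imp_t_finite:
  assumes acc: "acc {I :: 'a set. t_ideal I \<and> rad I = I}" and P: "t_prime (P :: 'a set)"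
  shows "t_finite P"
proof -
  define r where "r F = \<Inter>{Q :: 'a set. t_prime Q \<and> F \<subseteq> Q}" for F
  define C where "C = {r F | F. finite F \<and> F \<subseteq> P \<and> \<not> F \<subseteq> {0}}"
  obtain a where a: "a \<in> P" "a \<noteq> 0" using t_ideal_nonzero[OF t_prime_simps(3)[OF P]] .
  have "C \<subseteq> {I. t_ideal I \<and> rad I = I}"
    unfolding C_def r_def using Inter_t_primes_radical[OF P] by auto
  moreover have "r {a} \<in> C"
    unfolding C_def using a by (intro CollectI exI[of _ "{a}"]) simp
  ultimately have "\<exists>m\<in>C. r {a} \<subseteq> m \<and> (\<forall>y\<in>C. m \<subseteq> y \<longrightarrow> y = m)"
    by (intro acc_maximal[OF acc])
  then obtain m where m: "m \<in> C" "\<forall>y\<in>C. m \<subseteq> y \<longrightarrow> y = m" by (elim bexE conjE)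
  then obtain F where F: "m = r F" "finite F" "F \<subseteq> P" "\<not> F \<subseteq> {0}" unfolding C_def by blast
  have "P \<subseteq> r F"
  proof
    fix x assume x: "x \<in> P"
    have "r (insert x F) \<in> C"
      unfolding C_def using F x by (intro CollectI exI[of _ "insert x F"]) simp
    moreover have "r F \<subseteq> r (insert x F)" unfolding r_def by (intro Inter_anti_mono) auto
    ultimately have "r (insert x F) = r F" using m(2) F(1) by simp
    moreover have "x \<in> r (insert x F)" by (simp add: r_def)
    ultimately show "x \<in> r F" by simp
  qed
  then have "\<forall>Q. t_prime Q \<longrightarrow> F \<subseteq> Q \<longrightarrow> P \<subseteq> Q" unfolding r_def by blast
  with F show ?thesis unfolding t_finite_def by blast
qed

lemma t_finite_imp_acc_radical:
  assumes fin: "\<And>P :: 'a set. t_prime P \<Longrightarrow> t_finite P"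
  shows "acc {I :: 'a set. t_ideal I \<and> rad I = I}"
  unfolding acc_def
proof (intro allI impI, elim conjE)
  fix f :: "nat \<Rightarrow> 'a set"
  assume f0: "\<forall>n. f n \<in> {I. t_ideal I \<and> rad I = I}" and inc: "\<forall>n. f n \<subseteq> f (Suc n)"
  have f: "t_ideal (f n)" "rad (f n) = f n" for n using f0 by simp_all
  have idf: "is_ideal (f n)" for n using f(1) by (rule t_ideal_ideal)
  have nzf: "f n \<noteq> {0}" for n using f(1)[of n] by (simp add: t_ideal_iff)
  have mono: "mono f" using inc by (simp add: mono_iff_le_Suc)
  have mono': "x \<in> f n" if "x \<in> f m" "m \<le> n" for x m n using monoD[OF mono that(2)] that(1) by blast
  define I where "I = (\<Union>n. f n)"
  txt \<open>The chain stabilizes iff the ideal \<open>U\<close> lies in no maximal t-ideal.\<close>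
  define U where "U = {s. \<exists>n. \<forall>x\<in>I. s * x \<in> f n}"
  have U1: "is_ideal U" unfolding is_ideal_def
  proof (intro conjI ballI allI impI)
    show "0 \<in> U" unfolding U_def using ideal_0[OF idf] by simp
  next
    fix s t assume "s \<in> U" "t \<in> U"
    then obtain m n where mn: "\<forall>x\<in>I. s * x \<in> f m" "\<forall>x\<in>I. t * x \<in> f n" unfolding U_def by blast
    have "(s + t) * x \<in> f (max m n)" if "x \<in> I" for x
    proof -
      have "s * x \<in> f (max m n)" by (rule mono'[of _ m]) (use mn that in simp_all)
      moreover have "t * x \<in> f (max m n)" by (rule mono'[of _ n]) (use mn that in simp_all)
      ultimately show ?thesis unfolding distrib_right by (rule ideal_add[OF idf])
    qed
    then show "s + t \<in> U" unfolding U_def by blast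
  next
    fix r s assume "s \<in> U"
    then obtain n where "\<forall>x\<in>I. s * x \<in> f n" unfolding U_def by blast
    then have "\<forall>x\<in>I. (r * s) * x \<in> f n" using ideal_multl[OF idf] by (simp add: mult.assoc)
    then show "r * s \<in> U" unfolding U_def by blast
  qed
  have "f 0 \<subseteq> U"
  proof
    fix s assume "s \<in> f 0"
    then have "\<forall>x\<in>I. s * x \<in> f 0" using ideal_multr[OF idf] by blast
    then show "s \<in> U" unfolding U_def by blast
  qed
  moreover obtain a where "a \<in> f 0" "a \<noteq> 0" using t_ideal_nonzero[OF f(1)] .
  ultimately have U2: "U \<noteq> {0}" by blast
  have U3: "\<not> U \<subseteq> M" if M: "t_maximal M" for M
  proof
    assume UM: "U \<subseteq> M"
    note tM = t_maximal_prime[OF M]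
    have fM: "f n \<subseteq> M" for n
    proof (rule ccontr)
      assume "\<not> f n \<subseteq> M"
      then obtain s where s: "s \<in> f n" "s \<notin> M" by blast
      then have "\<forall>x\<in>I. s * x \<in> f n" using ideal_multr[OF idf] by blast
      then have "s \<in> U" unfolding U_def by blast
      with s UM show False by blast
    qed
    note p = loc_rad_t_prime[OF tM idf nzf fM]
    have "loc_rad (f n) M \<subseteq> loc_rad (f (Suc n)) M" for n
      using inc unfolding loc_rad_def by blast
    then have lmono: "mono (\<lambda>n. loc_rad (f n) M)" by (simp add: mono_iff_le_Suc)
    \<comment> \<open>The localized radicals are an increasing chain of t-primes. Since their union
      is \<open>t_finite\<close>, a single stage contains its finite set \<open>F\<close>.\<close>
    define P where "P = (\<Union>n. loc_rad (f n) M)"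
    have P: "t_prime P" unfolding P_def by (rule t_prime_Union_increasing[OF p(1) lmono])
    obtain F where F: "finite F" "F \<subseteq> P" "\<not> F \<subseteq> {0}"
      and FQ: "\<And>Q. t_prime Q \<Longrightarrow> F \<subseteq> Q \<Longrightarrow> P \<subseteq> Q"
      using t_finite_nonzero[OF P fin[OF P]] by blast
    have "\<exists>X\<in>range (\<lambda>n. loc_rad (f n) M). F \<subseteq> X"
    proof (rule chain_finite_subset[OF F(1)])
      show "F \<subseteq> \<Union>(range (\<lambda>n. loc_rad (f n) M))" using F(2) by (simp add: P_def)
      show "X \<subseteq> Y \<or> Y \<subseteq> X"
        if "X \<in> range (\<lambda>n. loc_rad (f n) M)" "Y \<in> range (\<lambda>n. loc_rad (f n) M)" for X Y
        using mono_range_chain[OF lmono that] .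
    qed simp
    then obtain n where n: "F \<subseteq> loc_rad (f n) M" by (elim bexE rangeE) simp
    have "\<exists>s. s \<notin> M \<and> s * a \<in> f n" if "a \<in> F" for a
    proof -
      obtain s k where s: "s \<notin> M" "s * a ^ Suc k \<in> f n" using n \<open>a \<in> F\<close> unfolding loc_rad_def by blast
      have "(s * a) ^ Suc k = s ^ k * (s * a ^ Suc k)" by (simp add: power_mult_distrib ac_simps)
      also have "\<dots> \<in> f n" using s(2) by (rule ideal_multl[OF idf])
      finally have "s * a \<in> rad (f n)" unfolding rad_def by blast
      with s f(2) show ?thesis by blast
    qed
    then obtain s where s: "\<And>a. a \<in> F \<Longrightarrow> s a \<notin> M" "\<And>a. a \<in> F \<Longrightarrow> s a * a \<in> f n" by metis
    define t where "t = prod s F"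
    have t: "t \<notin> M" unfolding t_def using t_prime_prod_notin[OF tM] s(1) by blast
    have tF: "t * a \<in> f n" if "a \<in> F" for a
    proof -
      have "s a * a dvd t * a"
        unfolding t_def using that F(1) by (intro mult_dvd_mono dvd_prodI dvd_refl)
      then show ?thesis using ideal_dvd[OF idf s(2)[OF that]] by blast
    qed
    \<comment> \<open>A t-prime above \<open>f n\<close> that omits \<open>t\<close> contains
      \<open>F\<close>, hence \<open>P\<close> and \<open>x\<close>. Thus \<open>t\<close>, which
      lies outside \<open>M\<close>, belongs to \<open>U\<close>.\<close>
    have "t * x \<in> f n" if x: "x \<in> I" for x
    proof (rule ccontr)
      assume "t * x \<notin> f n"
      then obtain Q where Q: "t_prime Q" "f n \<subseteq> Q" "t * x \<notin> Q"
        using radical_t_ideal_separate[OF f] by blast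
      have tx: "t \<notin> Q" "x \<notin> Q" using Q(3) t_prime_simps(7)[OF Q(1)] by blast+
      have "F \<subseteq> Q"
      proof
        fix a assume "a \<in> F"
        then have "t * a \<in> Q" using tF Q(2) by blast
        with tx(1) show "a \<in> Q" using t_prime_simps(7)[OF Q(1)] by blast
      qed
      then have "P \<subseteq> Q" by (rule FQ[OF Q(1)])
      moreover have "x \<in> P" using x p(2) unfolding I_def P_def by blast
      ultimately show False using tx(2) by blast
    qed
    then have "t \<in> U" unfolding U_def by blast
    with t UM show False by blast
  qed
  obtain G where G: "finite G" "G \<subseteq> U" "\<not> G \<subseteq> {0}" "in_v G 1"
    by (rule comaximal_in_v_1[OF U1 U2 U3])
  have "\<forall>g\<in>G. \<exists>n. \<forall>x\<in>I. g * x \<in> f n" using G(2) unfolding U_def by blast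
  then obtain k where k: "\<forall>g\<in>G. \<forall>x\<in>I. g * x \<in> f (k g)" by metis
  \<comment> \<open>Beyond the largest index used by \<open>G\<close>, all multiples of
    \<open>x\<close> by \<open>G\<close> lie in one t-ideal, and \<open>in_v G 1\<close> returns
    \<open>x\<close> itself.\<close>
  define N where "N = Max (k ` G)"
  have "I \<subseteq> f N"
  proof
    fix x assume x: "x \<in> I"
    have "(*) x ` G \<subseteq> f N"
    proof (rule image_subsetI)
      fix g assume g: "g \<in> G"
      have "k g \<le> N" unfolding N_def using G(1) g by (intro Max_ge) simp_all
      moreover have "x * g \<in> f (k g)" using k g x by (simp add: mult.commute)
      ultimately show "x * g \<in> f N" by (rule mono'[rotated])
    qed
    moreover have "in_v ((*) x ` G) (x * 1)" by (rule in_v_scale[OF G(4)])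
    ultimately have "x * 1 \<in> f N" using G(1) by (intro t_ideal_in_v[OF f(1)]) simp_all
    then show "x \<in> f N" by simp
  qed
  then have "f n = f N" if "n \<ge> N" for n
    using monoD[OF mono that] unfolding I_def by blast
  then show "\<exists>N. \<forall>n\<ge>N. f n = f N" by blast
qed

end

section \<open>Trace ideals\<close>

text \<open>The product \<open>I (R : I)\<close> is contained in \<open>R\<close>, so passing to its
  preimage under \<open>emb\<close> loses nothing.\<close>

definition trace :: "'a::idom set \<Rightarrow> 'a set" where
  "trace I = {x. emb x \<in> modprod (emb ` I) (colon Rf (emb ` I))}"

lemma modprod_0: "0 \<in> modprod A B"
  unfolding modprod_def by (intro CollectI exI[of _ 0]) simp

lemma modprod_add_term:
  assumes "z \<in> modprod A B" "x \<in> A" "y \<in> B"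
  shows "z + x * y \<in> modprod A B"
proof -
  obtain n a b where z: "z = (\<Sum>i<(n::nat). a i * b i)" "\<forall>i<n. a i \<in> A \<and> b i \<in> B"
    using assms(1) unfolding modprod_def by blast
  have "z + x * y = (\<Sum>i<Suc n. (a(n := x)) i * (b(n := y)) i)"
    by (simp add: z(1))
  moreover have "\<forall>i<Suc n. (a(n := x)) i \<in> A \<and> (b(n := y)) i \<in> B"
    using z(2) assms(2,3) by (simp add: less_Suc_eq)
  ultimately show ?thesis unfolding modprod_def by blast
qed

lemma modprod_induct [consumes 1, case_names zero add]:
  assumes "z \<in> modprod A B" and "Q 0"
    and step: "\<And>z x y. z \<in> modprod A B \<Longrightarrow> Q z \<Longrightarrow> x \<in> A \<Longrightarrow> y \<in> B \<Longrightarrow> Q (z + x * y)"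
  shows "Q z"
proof -
  obtain n a b where z: "z = (\<Sum>i<(n::nat). a i * b i)" "\<forall>i<n. a i \<in> A \<and> b i \<in> B"
    using assms(1) unfolding modprod_def by blast
  have "(\<Sum>i<m. a i * b i) \<in> modprod A B \<and> Q (\<Sum>i<m. a i * b i)" if "m \<le> n" for m
    using that
  proof (induction m)
    case 0
    show ?case using assms(2) modprod_0 by simp
  next
    case (Suc m)
    then have "a m \<in> A" "b m \<in> B" using z(2) by simp_all
    moreover from Suc have "(\<Sum>i<m. a i * b i) \<in> modprod A B" "Q (\<Sum>i<m. a i * b i)" by simp_all
    ultimately show ?case using modprod_add_term[of _ A B] step by simp
  qed
  then show ?thesis using z(1) by blast
qed

lemma modprod_add:
  assumes "z \<in> modprod A B" "w \<in> modprod A B"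
  shows "w + z \<in> modprod A B"
  using assms(1)
proof (induction rule: modprod_induct)
  case zero
  then show ?case using assms(2) by simp
next
  case (add z x y)
  then show ?case using modprod_add_term[of "w + z" A B x y] by (simp add: add.assoc)
qed

text \<open>The multiplier \<open>w\<close> is absorbed by the second factor; this serves both
  scalars from \<open>R\<close> and elements of \<open>(R : I I\<^sup>-\<^sup>1)\<close>.\<close>

lemma modprod_colon_mult:
  assumes z: "z \<in> modprod A B" and B: "\<And>y. y \<in> B \<Longrightarrow> w * y \<in> B"
  shows "w * z \<in> modprod A B"
  using z
proof (induction rule: modprod_induct)
  case zero
  then show ?case using modprod_0 by simp
next
  case (add z x y)
  then show ?case using modprod_add_term[of "w * z" A B x "w * y"] B
    by (simp add: distrib_left mult.left_commute)
qed

lemma modprod_colon_subset: "modprod A (colon Rf A) \<subseteq> Rf"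
proof
  fix z assume "z \<in> modprod A (colon Rf A)"
  then show "z \<in> Rf"
  proof (induction rule: modprod_induct)
    case zero
    show ?case using emb_in_Rf[of 0] by simp
  next
    case (add z x y)
    then have "x * y \<in> Rf" unfolding colon_def by (simp add: mult.commute)
    with add show ?case by (simp add: Rf_add)
  qed
qed

lemma emb_trace: "emb ` trace I = modprod (emb ` I) (colon Rf (emb ` I))"
  using modprod_colon_subset[of "emb ` I"] unfolding trace_def Rf_def by blast

lemma ideal_trace: "is_ideal (trace I)"
  unfolding is_ideal_def trace_def Ball_def mem_Collect_eq
proof (intro conjI allI impI)
  let ?X = "modprod (emb ` I) (colon Rf (emb ` I))"
  show "emb 0 \<in> ?X" by (simp add: modprod_0)
  show "emb (x + y) \<in> ?X" if "emb x \<in> ?X" "emb y \<in> ?X" for x y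
    unfolding emb_add by (rule modprod_add) (rule that)+
  show "emb (r * x) \<in> ?X" if "emb x \<in> ?X" for r x
    unfolding emb_mult
  proof (rule modprod_colon_mult[OF that])
    show "emb r * y \<in> colon Rf (emb ` I)" if "y \<in> colon Rf (emb ` I)" for y
      using that unfolding colon_def by (simp add: mult.assoc Rf_mult)
  qed
qed

lemma trace_superset: "I \<subseteq> trace I"
proof
  fix x assume x: "x \<in> I"
  have "1 \<in> colon Rf (emb ` I)" unfolding colon_def by simp
  with modprod_add_term[OF modprod_0, of "emb x" "emb ` I" 1] x show "x \<in> trace I"
    by (simp add: trace_def)
qed

text \<open>\<open>(R : I I\<^sup>-\<^sup>1) = (I\<^sup>-\<^sup>1 : I\<^sup>-\<^sup>1)\<close> is a ring and acts on the trace.\<close>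

lemma trace_colon_closed:
  assumes d: "d \<noteq> 0" and cd: "\<And>x. x \<in> trace I \<Longrightarrow> d dvd c * x"
    and x: "x \<in> trace I" "c * x = d * z"
  shows "z \<in> trace I"
proof -
  let ?w = "emb c / emb d"
  have "emb c * emb x = emb d * emb z" using x(2) by (simp flip: emb_mult)
  then have z: "emb z = ?w * emb x" using d by (simp add: field_simps)
  have "?w * emb x \<in> modprod (emb ` I) (colon Rf (emb ` I))"
  proof (rule modprod_colon_mult)
    show "emb x \<in> modprod (emb ` I) (colon Rf (emb ` I))" using x(1) by (simp add: trace_def)
    fix y assume y: "y \<in> colon Rf (emb ` I)"
    show "?w * y \<in> colon Rf (emb ` I)" unfolding colon_def
    proof (intro CollectI ballI)
      fix i assume i: "i \<in> emb ` I"
      \<comment> \<open>The product \<open>y * i\<close> is itself in the trace, so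
        \<open>?w\<close> maps it into \<open>R\<close>; this is why \<open>?w * y\<close> stays in
        the inverse of \<open>I\<close>.\<close>
      have "y * i \<in> modprod (emb ` I) (colon Rf (emb ` I))"
        using modprod_add_term[OF modprod_0 i y] by (simp add: mult.commute)
      then obtain t where t: "t \<in> trace I" "y * i = emb t" unfolding emb_trace[symmetric] by blast
      have "?w * y * i = emb (c * t) / emb d" using t(2) by (simp add: mult.assoc emb_mult)
      then show "?w * y * i \<in> Rf" using cd[OF t(1)] d by (simp add: emb_div_in_Rf_iff)
    qed
  qed
  then show ?thesis by (simp add: trace_def z)
qed

lemma tRTP_iff:
  "tRTP (R :: 'a::idom itself) \<longleftrightarrow> (\<forall>I::'a set. is_ideal I \<and> I \<noteq> {0} \<longrightarrow>
     tcl (trace I) = UNIV \<or> (\<forall>x n. x ^ Suc n \<in> tcl (trace I) \<longrightarrow> x \<in> tcl (trace I)))"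
proof -
  have 1: "emb ` X = Rf \<longleftrightarrow> X = UNIV" for X :: "'a set"
    unfolding Rf_def by (rule inj_image_eq_iff[OF inj_emb])
  have 2: "radical_in_R (emb ` X) \<longleftrightarrow> (\<forall>x n. x ^ Suc n \<in> X \<longrightarrow> x \<in> X)" for X :: "'a set"
    unfolding radical_in_R_def Rf_def
    by (simp add: inj_image_mem_iff[OF inj_emb] del: power_Suc flip: emb_power)
  show ?thesis
    unfolding tRTP_def Let_def emb_trace[symmetric] tclos_emb[OF ideal_trace] 1 2 ..
qed

section \<open>The trace property and t-finiteness\<close>

context pvmd_domain
begin

text \<open>The action on the trace passes to its t-closure by clearing denominators at each maximal
  t-ideal.\<close>

lemma tcl_trace_colon_closed:
  fixes c d :: 'a
  assumes I: "is_ideal I" "I \<noteq> {0}"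
    and d: "d \<noteq> 0" and cd: "\<And>x. x \<in> tcl (trace I) \<Longrightarrow> d dvd c * x"
    and x: "x \<in> tcl (trace I)" "c * x = d * z"
  shows "z \<in> tcl (trace I)"
proof -
  have nz: "trace I \<noteq> {0}" using I trace_superset[of I] ideal_0[OF I(1)] by blast
  note iff = tcl_iff[OF ideal_trace nz]
  have "\<exists>s. s \<notin> M \<and> s * z \<in> trace I" if M: "t_maximal M" for M
  proof -
    obtain s where s: "s \<notin> M" "s * x \<in> trace I" using x(1) M unfolding iff by blast
    have "c * (s * x) = s * (c * x)" by (simp add: ac_simps)
    then have eq: "c * (s * x) = d * (s * z)" unfolding x(2) by (simp add: ac_simps)
    have "s * z \<in> trace I"
    proof (rule trace_colon_closed[OF d _ s(2) eq])
      show "d dvd c * y" if "y \<in> trace I" for y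
        using cd tcl_superset[OF ideal_trace nz] that by blast
    qed
    with s(1) show ?thesis by blast
  qed
  then show ?thesis unfolding iff by blast
qed

lemma t_finite_imp_tRTP:
  assumes fin: "\<And>P :: 'a set. t_prime P \<Longrightarrow> t_finite P"
  shows "tRTP R"
  unfolding tRTP_iff
proof (intro allI impI disjI2, elim conjE)
  fix I :: "'a set" and x n
  assume I: "is_ideal I" "I \<noteq> {0}" and x: "x ^ Suc n \<in> tcl (trace I)"
  define T where "T = tcl (trace I)"
  note closed = tcl_trace_colon_closed[OF I, folded T_def]
  have nz: "trace I \<noteq> {0}" using I trace_superset[of I] ideal_0[OF I(1)] by blast
  have T: "t_ideal T" unfolding T_def by (rule t_ideal_tcl[OF ideal_trace nz])
  have idT: "is_ideal T" and nzT: "T \<noteq> {0}" using T by (simp_all add: t_ideal_iff)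
  show "x \<in> tcl (trace I)" unfolding T_def[symmetric]
  proof (rule ccontr)
    assume "x \<notin> T"
    then obtain M where M: "t_maximal M" and xM: "\<And>s. s \<notin> M \<Longrightarrow> s * x \<notin> T"
      using t_ideal_local[OF T] by blast
    note tM = t_maximal_prime[OF M]
    have TM: "T \<subseteq> M" using xM ideal_multr[OF idT] by blast
    define P where "P = loc_rad T M"
    have P: "t_prime P" and TP: "T \<subseteq> P" and PM: "P \<subseteq> M"
      unfolding P_def by (rule loc_rad_t_prime[OF tM idT nzT TM])+
    have P_mem: "\<exists>s n. s \<notin> P \<and> s * y ^ Suc n \<in> T" if y: "y \<in> P" for y
    proof -
      obtain s n where "s \<notin> M" "s * y ^ Suc n \<in> T" using y unfolding P_def loc_rad_def by blast
      with PM show ?thesis by blast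
    qed
    have "x ^ Suc n \<in> P" using x TP unfolding T_def by blast
    then have xP: "x \<in> P" by (simp only: t_prime_simps(8)[OF P])
    have x0: "x \<noteq> 0" using \<open>x \<notin> T\<close> ideal_0[OF idT] by blast
    obtain F where F: "finite F" "F \<subseteq> P" "\<not> F \<subseteq> {0}"
      and FQ: "\<And>Q. t_prime Q \<Longrightarrow> F \<subseteq> Q \<Longrightarrow> P \<subseteq> Q"
      using t_finite_nonzero[OF P fin[OF P]] by blast
    txt \<open>An element of the quotient field lies in \<open>(R : T)\<close> as soon as it lies in \<open>R\<^sub>N\<close> for
      the maximal t-ideals \<open>N\<close> not containing \<open>P\<close> and multiplies \<open>T\<close> into \<open>P R\<^sub>P\<close>.\<close>
    have "\<exists>s. s \<notin> P \<and> s * x \<in> T"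
    proof (rule ccontr)
      assume "\<not> ?thesis"
      then have no: "s * x \<notin> T" if "s \<notin> P" for s using that by blast
      \<comment> \<open>If \<open>x \<notin> T R\<^sub>P\<close>, then \<open>T\<close> is contained
        in \<open>x P R\<^sub>P\<close>. This makes \<open>t/x\<close>, with \<open>t\<close>
        defined below, an element of \<open>(R : T)\<close>.\<close>
      have Tx: "\<exists>s k. s \<notin> P \<and> k \<in> P \<and> s * t = x * k" if t: "t \<in> T" for t
      proof -
        obtain s where s: "s \<notin> P" "x dvd s * t \<or> t dvd s * x" by (rule t_prime_valuation[OF P])
        then have "x dvd s * t" using no[OF s(1)] ideal_dvd[OF idT t] by blast
        then obtain k where k: "s * t = x * k" unfolding dvd_def by blast
        have "k * x \<in> T" using ideal_multl[OF idT t, of s] unfolding k by (simp add: mult.commute)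
        then have "k \<in> P" using no by blast
        with s k show ?thesis by blast
      qed
      have "\<exists>s. s \<notin> P \<and> (\<exists>m. x dvd s * a ^ Suc m)" if a: "a \<in> F" for a
      proof -
        obtain s m where s: "s \<notin> P" "s * a ^ Suc m \<in> T" using P_mem a F(2) by blast
        obtain r k where r: "r \<notin> P" "r * (s * a ^ Suc m) = x * k" using Tx[OF s(2)] by blast
        then have "x dvd (r * s) * a ^ Suc m" by (simp only: mult.assoc dvd_triv_left)
        moreover have "r * s \<notin> P" using r(1) s(1) t_prime_simps(7)[OF P] by blast
        ultimately show ?thesis by blast
      qed
      then obtain s where s: "\<And>a. a \<in> F \<Longrightarrow> s a \<notin> P" "\<And>a. a \<in> F \<Longrightarrow> \<exists>m. x dvd s a * a ^ Suc m"
        by metis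
      define t where "t = prod s F"
      have tP: "t \<notin> P" unfolding t_def using t_prime_prod_notin[OF P] s(1) by blast
      have tF: "\<exists>m. x dvd t * a ^ Suc m" if a: "a \<in> F" for a
      proof -
        obtain m where m: "x dvd s a * a ^ Suc m" using s(2)[OF a] by blast
        have "s a * a ^ Suc m dvd t * a ^ Suc m"
          unfolding t_def using a F(1) by (intro mult_dvd_mono dvd_prodI dvd_refl)
        with m have "x dvd t * a ^ Suc m" by (rule dvd_trans)
        then show ?thesis by blast
      qed
      have div: "x dvd t * y" if y: "y \<in> T" for y
      proof (rule dvd_if_locally_dvd[OF x0])
        fix N :: "'a set" assume N: "t_maximal N"
        note tN = t_maximal_prime[OF N]
        show "\<exists>r. r \<notin> N \<and> x dvd r * (t * y)"
        proof (cases "P \<subseteq> N")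
          case True
          obtain s k where s: "s \<notin> P" "k \<in> P" "s * y = x * k" using Tx[OF y] by blast
          obtain r where r: "r \<notin> N" "s dvd r * k"
            by (rule t_prime_divided[OF tN P True s(2,1)])
          then obtain k' where k': "r * k = s * k'" unfolding dvd_def by blast
          have "s \<noteq> 0" using s(1) t_prime_simps(4)[OF P] by blast
          have "s * (r * y) = r * (s * y)" by (simp add: ac_simps)
          also have "\<dots> = x * (r * k)" unfolding s(3) by (simp add: ac_simps)
          also have "\<dots> = s * (x * k')" unfolding k' by (simp add: ac_simps)
          finally have ry: "r * y = x * k'" using \<open>s \<noteq> 0\<close> by simp
          have "r * (t * y) = t * (r * y)" by (simp add: ac_simps)
          also have "\<dots> = x * (t * k')" unfolding ry by (simp add: ac_simps)
          finally show ?thesis using r(1) by (metis dvd_triv_left)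
        next
          case False
          then obtain a where a: "a \<in> F" "a \<notin> N" using FQ[OF tN] by blast
          obtain m where m: "x dvd t * a ^ Suc m" using tF[OF a(1)] by blast
          then have "x dvd y * (t * a ^ Suc m)" by (rule dvd_mult)
          then have "x dvd a ^ Suc m * (t * y)" by (simp only: ac_simps)
          moreover have "a ^ Suc m \<notin> N" using a(2) by (rule t_prime_power_notin[OF tN])
          ultimately show ?thesis by blast
        qed
      qed
      obtain s m where s: "s \<notin> P" "s * x ^ Suc m \<in> T" using P_mem[OF xP] by blast
      \<comment> \<open>Repeated action of \<open>t/x\<close> trades powers of \<open>x\<close> for
        powers of \<open>t\<close>, ending with \<open>s * t ^ Suc m\<close> in \<open>T\<close>,
        although neither factor lies in \<open>P\<close>.\<close>
      have "s * x ^ (Suc m - j) * t ^ j \<in> T" if "j \<le> Suc m" for j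
        using that
      proof (induction j)
        case 0
        show ?case using s(2) by simp
      next
        case (Suc j)
        then have IH: "s * x ^ (Suc m - j) * t ^ j \<in> T" by simp
        have "Suc m - j = Suc (Suc m - Suc j)" using Suc.prems by simp
        then have "t * (s * x ^ (Suc m - j) * t ^ j) = x * (s * x ^ (Suc m - Suc j) * t ^ Suc j)"
          by (simp add: ac_simps)
        with x0 div IH show ?case by (rule closed)
      qed
      from this[of "Suc m"] have "s * t ^ Suc m \<in> P" using TP by auto
      moreover have "t ^ Suc m \<notin> P" using tP by (rule t_prime_power_notin[OF P])
      ultimately show False using s(1) t_prime_simps(7)[OF P] by blast
    qed
    then obtain s where s: "s \<notin> P" "s * x \<in> T" by blast
    have s0: "s \<noteq> 0" using s(1) t_prime_simps(4)[OF P] by blast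
    \<comment> \<open>It remains to pass from \<open>R\<^sub>P\<close> to \<open>R\<^sub>M\<close>:
      the fraction \<open>q/s\<close> lies in \<open>(R : T)\<close> and sends \<open>s * x\<close>
      to \<open>q * x\<close>, with \<open>q \<notin> M\<close>.\<close>
    obtain q where q: "q \<notin> M" "\<And>a. a \<in> F \<Longrightarrow> s dvd q * a"
      using t_prime_divided_finite[OF tM P PM F(1,2) s(1)] by blast
    have div: "s dvd q * y" if y: "y \<in> T" for y
    proof (rule dvd_if_locally_dvd[OF s0])
      fix N :: "'a set" assume N: "t_maximal N"
      note tN = t_maximal_prime[OF N]
      show "\<exists>r. r \<notin> N \<and> s dvd r * (q * y)"
      proof (cases "P \<subseteq> N")
        case True
        have "y \<in> P" using y TP by blast
        then obtain r where r: "r \<notin> N" "s dvd r * y"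
          using t_prime_divided[OF tN P True _ s(1)] by blast
        from r(2) have "s dvd q * (r * y)" by (rule dvd_mult)
        then have "s dvd r * (q * y)" by (simp only: ac_simps)
        with r(1) show ?thesis by blast
      next
        case False
        then obtain a where a: "a \<in> F" "a \<notin> N" using FQ[OF tN] by blast
        have "s dvd y * (q * a)" using q(2)[OF a(1)] by (rule dvd_mult)
        then have "s dvd a * (q * y)" by (simp only: ac_simps)
        with a(2) show ?thesis by blast
      qed
    qed
    have "q * (s * x) = s * (q * x)" by (simp only: ac_simps)
    with s0 div s(2) have "q * x \<in> T" by (rule closed)
    with xM[OF q(1)] show False by blast
  qed
qed

lemma tRTP_imp_t_finite:
  assumes rtp: "tRTP R" and acc: "acc {P :: 'a set. t_prime P}" and P: "t_prime (P :: 'a set)"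
  shows "t_finite P"
proof -
  txt \<open>The trace of the \<open>P\<close>-primary ideal \<open>Q = a\<^sup>2 R\<^sub>P \<inter> R\<close> contains \<open>a\<close>, so \<open>(R : Q)\<close> is not
    contained in \<open>R\<^sub>P\<close>.\<close>
  obtain a where a: "a \<in> P" "a \<noteq> 0" "\<And>Q. t_prime Q \<Longrightarrow> Q \<subseteq> P \<Longrightarrow> a \<in> Q \<Longrightarrow> Q = P"
    using acc_t_prime_minimal_over[OF acc P] by blast
  define Q where "Q = contr (a * a) P"
  have idQ: "is_ideal Q" unfolding Q_def by (rule ideal_contr[OF P])
  have aaQ: "a * a \<in> Q" unfolding Q_def by (rule contr_member[OF P])
  have radQ: "rad Q = P" unfolding Q_def by (rule rad_contr[OF P a])
  have aQ: "a \<notin> Q" unfolding Q_def by (rule contr_square_notin[OF P a(1,2)])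
  have Q_cancel: "z \<in> Q" if z: "s * z \<in> Q" "s \<notin> P" for s z
  proof -
    obtain r where "r \<notin> P" "a * a dvd r * (s * z)" using z(1) unfolding Q_def contr_def by blast
    then have "r * s \<notin> P" "a * a dvd (r * s) * z"
      using z(2) t_prime_simps(7)[OF P] by (simp_all only: mult.assoc) simp
    then show ?thesis unfolding Q_def contr_def by blast
  qed
  have "a * a \<noteq> 0" using a(2) by simp
  then have nzQ: "Q \<noteq> {0}" using aaQ by blast
  have nzT: "trace Q \<noteq> {0}" using nzQ trace_superset[of Q] ideal_0[OF idQ] by blast
  have "a ^ Suc 1 \<in> tcl (trace Q)"
    using aaQ trace_superset[of Q] tcl_superset[OF ideal_trace nzT] by auto
  \<comment> \<open>Whichever alternative of the trace property holds, all of \<open>R\<close> or a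
    radical ideal, it yields \<open>a\<close> from its square.\<close>
  then have "a \<in> tcl (trace Q)" using rtp idQ nzQ unfolding tRTP_iff by (metis UNIV_I)
  moreover obtain M where M: "t_maximal M" "P \<subseteq> M" using t_prime_in_t_maximal[OF P] by blast
  ultimately obtain s where s: "s \<notin> P" "s * a \<in> trace Q"
    unfolding tcl_iff[OF ideal_trace nzT] by blast
  \<comment> \<open>If \<open>(R : Q)\<close> were inside \<open>R\<^sub>P\<close>, then
    \<open>Q (R : Q)\<close> would lie in \<open>Q R\<^sub>P \<inter> R = Q\<close>, giving
    \<open>s * a \<in> Q\<close> and so \<open>a \<in> Q\<close>.\<close>
  have "\<exists>c d. d \<noteq> 0 \<and> (\<forall>q\<in>Q. d dvd c * q) \<and> (\<forall>r. r \<notin> P \<longrightarrow> \<not> d dvd r * c)"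
  proof (rule ccontr)
    assume no: "\<not> ?thesis"
    have "y \<in> emb ` Q" if "y \<in> modprod (emb ` Q) (colon Rf (emb ` Q))" for y
      using that
    proof (induction rule: modprod_induct)
      case zero
      show ?case using ideal_0[OF idQ] emb_0 by (metis imageI)
    next
      case (add y u v)
      obtain z q where zq: "y = emb z" "z \<in> Q" "u = emb q" "q \<in> Q" using add.IH add.hyps(2) by blast
      obtain c d where cd: "d \<noteq> 0" "v = emb c / emb d" by (rule fract_cases_emb)
      have "d dvd c * q'" if "q' \<in> Q" for q'
      proof -
        have "v * emb q' \<in> Rf" using add.hyps(3) that unfolding colon_def by blast
        then show ?thesis
          using cd by (simp add: emb_div_in_Rf_iff[OF cd(1), symmetric] emb_mult)
      qed
      then obtain r k m where r: "r \<notin> P" "r * c = d * m" and k: "c * q = d * k"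
        using no cd(1) zq(4) unfolding dvd_def by metis
      have "emb c * emb q = emb d * emb k" using k by (simp flip: emb_mult)
      then have uv: "u * v = emb k"
        unfolding cd(2) zq(3) using cd(1) by (simp add: nonzero_divide_eq_eq mult.commute)
      have "d * (r * k) = r * (c * q)" unfolding k by (simp only: ac_simps)
      also have "\<dots> = (r * c) * q" by (simp only: ac_simps)
      also have "\<dots> = d * (m * q)" unfolding r(2) by (simp only: ac_simps)
      finally have "r * k = m * q" using cd(1) by simp
      then have "r * k \<in> Q" using ideal_multl[OF idQ zq(4)] by simp
      then have "k \<in> Q" using r(1) by (rule Q_cancel)
      then have "z + k \<in> Q" using zq(2) ideal_add[OF idQ] by blast
      then show ?case unfolding uv zq(1) emb_add[symmetric] by blast
    qed
    then have "emb (s * a) \<in> emb ` Q" using s(2) unfolding trace_def by blast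
    then have "s * a \<in> Q" by (simp only: inj_image_mem_iff[OF inj_emb])
    then have "a \<in> Q" using s(1) by (rule Q_cancel)
    with aQ show False by blast
  qed
  then obtain c d where cd: "d \<noteq> 0" "\<forall>q\<in>Q. d dvd c * q" "\<forall>r. r \<notin> P \<longrightarrow> \<not> d dvd r * c" by blast
  show ?thesis
  proof (rule t_finite_if_separated[OF P cd(1)])
    show "\<not> d dvd r * c" if "r \<notin> P" for r using cd(3) that by blast
    fix N assume N: "t_prime N" "\<not> P \<subseteq> N"
    \<comment> \<open>As \<open>P\<close> is the radical of \<open>Q\<close>, some
      \<open>q \<in> Q\<close> avoids \<open>N\<close> and serves as a denominator of
      \<open>c/d\<close> there.\<close>
    have "\<not> Q \<subseteq> N"
    proof
      assume "Q \<subseteq> N"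
      then have "rad Q \<subseteq> rad N" unfolding rad_def by blast
      with N radQ t_prime_rad[OF N(1)] show False by simp
    qed
    then obtain q where q: "q \<in> Q" "q \<notin> N" by blast
    then have "d dvd c * q" using cd(2) by blast
    then have "d dvd q * c" by (simp only: mult.commute)
    with q(2) show "\<exists>s. s \<notin> N \<and> d dvd s * c" by blast
  qed
qed

end

theorem theorem1p11:
  fixes R :: "'a::idom itself"
  assumes notfield: "Rf \<noteq> (UNIV :: 'a fract set)"
    and pvmd: "PvMD R"
  shows "(acc {I::'a set. t_ideal I \<and> rad I = I}
            \<longleftrightarrow> tRTP R \<and> acc {P::'a set. t_prime P})
       \<and> (tRTP R \<and> acc {P::'a set. t_prime P}
            \<longleftrightarrow> t_sharp_sharp R \<and> acc {P::'a set. t_prime P})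
       \<and> (t_sharp_sharp R \<and> acc {P::'a set. t_prime P}
            \<longleftrightarrow> t_sharp_sharp R \<and> (\<forall>P::'a set. t_prime P \<longrightarrow> branched P))"
proof -
  interpret pvmd_domain R by unfold_locales (rule pvmd)
  \<comment> \<open>The conditions with a chain condition are each reduced to \<open>?fin\<close>
    together with \<open>?acc\<close>; branching then replaces \<open>?acc\<close> in the last
    one.\<close>
  let ?fin = "\<forall>P::'a set. t_prime P \<longrightarrow> t_finite P"
  let ?acc = "acc {P::'a set. t_prime P}"
  have radical: "acc {I::'a set. t_ideal I \<and> rad I = I} \<longleftrightarrow> ?fin \<and> ?acc"
    using acc_radical_imp_t_finite t_finite_imp_acc_radical acc_radical_imp_acc_prime by blast
  have rtp: "tRTP R \<and> ?acc \<longleftrightarrow> ?fin \<and> ?acc"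
    using tRTP_imp_t_finite t_finite_imp_tRTP by blast
  have tss: "t_sharp_sharp R \<and> ?acc \<longleftrightarrow> ?fin \<and> ?acc"
    using t_sharp_sharp_imp_t_finite t_finite_imp_t_sharp_sharp by blast
  have br: "?acc \<longleftrightarrow> (\<forall>P::'a set. t_prime P \<longrightarrow> branched P)"
    using acc_imp_branched branched_imp_acc by blast
  show ?thesis unfolding radical rtp tss br[symmetric] by blast
qed

end
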